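(* Let $\alpha>0$, let $N\ge 0$ be an integer and $h>0$, and consider two finite sequences $\{\mathbf f_k\}_{k=0}^{N}$ and $\{\mathbf g_k\}_{k=0}^{N}$ with $\mathbf f_k=(f_k^1,\ldots,f_k^r)^\top\in\mathbb R^r$ and $\mathbf g_k=(g_k^1,\ldots,g_k^r)^\top\in\mathbb R^r$. Let $\mathcal J_-^{\alpha}$ and $\mathcal J_+^{\alpha}$ be the retarded and advanced Runge-Kutta convolution quadratures of order $\alpha$ with step $h$ associated with an $r$-stage Runge-Kutta method, as defined in the context. Then: (1) (Semigroup property) For $\sigma\in\{-,+\}$ and every $k=0,\ldots,N$, $$\mathcal J_\sigma^{\alpha}\circ\mathcal J_\sigma^{\alpha}\,\mathbf f_k=\mathcal J_\sigma^{(2\alpha)}\mathbf f_k .$$ (2) (Asymmetric integration by parts) $$\sum_{k=0}^{N}\left\langle \mathbf g_k,\mathcal J_-^{\alpha}\mathbf f_k\right\rangle=\sum_{k=0}^{N}\left\langle \mathcal J_+^{\alpha}\mathbf g_k,\mathbf f_k\right\rangle ,$$ where $\langle\cdot,\cdot\rangle$ is the Euclidean inner product on $\mathbb R^r$.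
   Context: Consider an $r$-stage Runge-Kutta method with coefficient matrix $A=(a_{ij})\in\mathbb R^{r\times r}$, weights $\mathbf b\in\mathbb R^r$ and abscissae $\mathbf c\in[0,1]^r$; let $\mathds{1}=(1,\ldots,1)^\top\in\mathbb R^r$ and let $R(z)=1+z\,\mathbf b^\top(I-zA)^{-1}\mathds 1$ be its stability function. Standing assumptions: $A$ is invertible; $|R(iy)|\le 1$ for all real $y$; $R(z)$ is analytic for $\mathrm{Re}(z)<1$. Put $$\gamma(z)=\Big(A+\frac{z}{1-z}\mathds 1\,\mathbf b^\top\Big)^{-1}=A^{-1}-z\,A^{-1}\mathds 1\,\mathbf b^\top A^{-1}.$$ For an order $\beta>0$ let $K^{(\beta)}(s)=s^{-\beta}$ (principal branch). The convolution weights $W_n^{(\beta)}\in\mathbb R^{r\times r}$, $n\ge0$, are the coefficients of the matrix power series at $z=0$ $$K^{(\beta)}\Big(\frac{\gamma(z)}{h}\Big)=\sum_{n=0}^{\infty}W_n^{(\beta)}z^n,$$ where $K^{(\beta)}$ is applied to matrices via the holomorphic functional calculus; it is understood that no eigenvalue of $A$ lies in $(-\infty,0]$, so that this makes sense near $z=0$. For a sequence $\{\mathbf f_k\}_{k=0}^N$ in $\mathbb R^r$, the retarded and advanced convolution quadratures are the sequences $$\mathcal J_-^{\beta}\mathbf f_k=\sum_{n=0}^{k}W_{k-n}^{(\beta)}\mathbf f_n=\sum_{n=0}^{k}W_{n}^{(\beta)}\mathbf f_{k-n},\qquad \mathcal J_+^{\beta}\mathbf f_k=\sum_{n=0}^{N-k}\big[W_n^{(\beta)}\big]^\top\mathbf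 f_{k+n},\qquad k=0,\ldots,N.$$ The composition $\mathcal J_\sigma^{\alpha}\circ\mathcal J_\sigma^{\alpha}\mathbf f_k$ is the $k$-th term of the sequence obtained by applying $\mathcal J_\sigma^{\alpha}$ to the sequence $\{\mathcal J_\sigma^{\alpha}\mathbf f_k\}_{k=0}^N$. $\mathcal J_\sigma^{(2\alpha)}$ denotes the operator of order $\beta=2\alpha$. *)

theory Defs
  imports "HOL-Complex_Analysis.Complex_Analysis"
begin

no_notation fps_nth (infixl "$" 75)

abbreviation cmat :: "real^'n^'m \<Rightarrow> complex^'n^'m" where
  "cmat \<equiv> map_matrix complex_of_real"

definition spectrum :: "complex^'n^'n \<Rightarrow> complex set" where
  "spectrum M = {s. \<exists>v. v \<noteq> 0 \<and> M *v v = s *s v}"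

text \<open>A cycle (finite family of closed paths) in \<^term>\<open>U - S\<close> that winds once around every
  point of \<^term>\<open>S\<close> and not at all around the points outside \<^term>\<open>U\<close>.
  A cycle rather than one closed path, since a spectrum may need several loops.\<close>

definition encloses :: "(real \<Rightarrow> complex) list \<Rightarrow> complex set \<Rightarrow> complex set \<Rightarrow> bool" where
  "encloses \<Gamma> U S \<longleftrightarrow>
     (\<forall>g\<in>set \<Gamma>. valid_path g \<and> pathfinish g = pathstart g \<and> path_image g \<subseteq> U - S) \<and>
     (\<forall>w\<in>S. (\<Sum>g\<leftarrow>\<Gamma>. winding_number g w) = 1) \<and>
     (\<forall>w. w \<notin> U \<longrightarrow> (\<Sum>g\<leftarrow>\<Gamma>. winding_number g w) = 0)"

text \<open>The Dunford integral
  \<open>f(M) = 1/(2\<pi>\<i>) \<integral>\<^sub>\<Gamma> f(s) (s I - M)\<inverse> ds\<close>, taken entrywise; its value is the common one of all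
  admissible \<open>\<Gamma>\<close>. Meaningful for \<^term>\<open>f\<close> holomorphic on the open set \<^term>\<open>U\<close>
  and \<^term>\<open>spectrum M \<subseteq> U\<close>.\<close>

definition hol_calc ::
    "complex set \<Rightarrow> (complex \<Rightarrow> complex) \<Rightarrow> complex^'n^'n \<Rightarrow> complex^'n^'n" where
  "hol_calc U f M = (THE B. \<forall>\<Gamma>. encloses \<Gamma> U (spectrum M) \<longrightarrow>
     B = (\<chi> i j. 1 / (2 * of_real pi * \<i>) *
           (\<Sum>g\<leftarrow>\<Gamma>. contour_integral g (\<lambda>s. f s * matrix_inv (mat s - M) $ i $ j))))"

text \<open>\<^const>\<open>remove_sings\<close> makes this the rational function \<open>R\<close>: where \<open>I - z A\<close> is singular,
  \<^const>\<open>matrix_inv\<close> is an arbitrary matrix, and \<open>R\<close> may or may not have a pole there.\<close>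

definition stability_function :: "real^'r^'r \<Rightarrow> real^'r \<Rightarrow> complex \<Rightarrow> complex" where
  "stability_function A b = remove_sings (\<lambda>z.
     1 + z * (\<Sum>i\<in>UNIV. of_real (b $ i) *
               (matrix_inv (mat 1 - map_matrix ((*) z) (cmat A)) *v 1) $ i))"

text \<open>The \<open>(i, j)\<close> entry of \<open>1 b\<^sup>T\<close> is \<open>b\<^sub>j\<close>.\<close>

definition rk_gamma :: "real^'r^'r \<Rightarrow> real^'r \<Rightarrow> complex \<Rightarrow> complex^'r^'r" where
  "rk_gamma A b z =
     matrix_inv (cmat A + map_matrix ((*) (z / (1 - z))) (cmat (\<chi> i j. b $ j)))"

text \<open>The closed form \<open>A\<inverse> - z A\<inverse> 1 b\<^sup>T A\<inverse>\<close> of \<^const>\<open>rk_gamma\<close> needs \<open>b\<^sup>T A\<inverse> 1 = 1\<close>,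
  that is \<open>R(\<infinity>) = 0\<close>.\<close>

lemma rk_gamma_closed_form:
  fixes A :: "real^'r^'r" and b :: "real^'r"
  assumes A: "invertible A" and b: "b \<bullet> (matrix_inv A *v 1) = 1" and z: "z \<noteq> 1"
  shows "rk_gamma A b z = cmat (matrix_inv A) -
    map_matrix ((*) z) (cmat (matrix_inv A ** (\<chi> i j. b $ j) ** matrix_inv A))"
proof -
  define E where "E = cmat (\<chi> (i::'r) j. b $ j)"
  define B where "B = cmat (matrix_inv A)"
  define t where "t = z / (1 - z)"
  have cm: "cmat (X ** Y) = cmat X ** cmat Y" for X Y :: "real^'r^'r"
    by (simp add: map_matrix_def matrix_matrix_mult_def vec_eq_iff)
  have sl: "map_matrix ((*) c) X ** Y = map_matrix ((*) c) (X ** Y)"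
    and sr: "X ** map_matrix ((*) c) Y = map_matrix ((*) c) (X ** Y)"
    for c and X Y :: "complex^'r^'r"
    by (simp_all add: map_matrix_def matrix_matrix_mult_def vec_eq_iff sum_distrib_left mult_ac)
  have iA: "A ** matrix_inv A = mat 1"
    using someI_ex[OF A[unfolded invertible_def]] by (simp add: matrix_inv_def)
  have "cmat (mat 1 :: real^'r^'r) = mat 1"
    by (simp add: vec_eq_iff mat_def)
  then have AB: "cmat A ** B = mat 1"
    unfolding B_def using cm iA by metis
  have "(\<chi> (i::'r) j. b $ j) ** matrix_inv A ** (\<chi> (i::'r) j. b $ j) =
      (\<chi> i j. (b \<bullet> (matrix_inv A *v 1)) * b $ j)"
    by (simp add: vec_eq_iff matrix_matrix_mult_def matrix_vector_mult_def inner_vec_def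
        sum_distrib_left sum_distrib_right mult_ac) (intro allI sum.swap)
  then have EBE: "E ** B ** E = E"
    unfolding E_def B_def using b by (simp flip: cm)
  have add_r: "(X + Y) ** Z = X ** Z + Y ** Z" and diff_l: "Z ** (X - Y) = Z ** X - Z ** Y"
    for X Y Z :: "complex^'r^'r"
    by (simp_all add: matrix_matrix_mult_def vec_eq_iff algebra_simps sum.distrib sum_subtractf)
  let ?N = "B - map_matrix ((*) z) (B ** E ** B)"
  let ?M = "cmat A + map_matrix ((*) t) E"
  have "?M ** ?N = cmat A ** B - map_matrix ((*) z) (cmat A ** B ** E ** B)
      + map_matrix ((*) t) (E ** B) - map_matrix ((*) t) (map_matrix ((*) z) (E ** B ** E ** B))"
    by (simp add: add_r diff_l sl sr matrix_mul_assoc) (simp add: vec_eq_iff algebra_simps)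
  also have "\<dots> = mat 1"
  proof -
    have "t - z - t * z = 0" using z by (simp add: t_def divide_simps) (simp add: algebra_simps)
    then have eq: "t * x - z * x - t * (z * x) = 0" for x
      by (simp only: left_diff_distrib[symmetric] mult.assoc[symmetric] mult_zero_left)
    have "map_matrix ((*) t) X - map_matrix ((*) z) X - map_matrix ((*) t) (map_matrix ((*) z) X) = 0"
      for X :: "complex^'r^'r"
      by (simp only: vec_eq_iff nth_map_matrix vector_minus_component zero_index eq simp_thms)
    from this[of "E ** B"] show ?thesis
      by (simp only: AB EBE matrix_mul_lid) (simp add: algebra_simps)
  qed
  finally have MN: "?M ** ?N = mat 1" .
  then have "?N ** ?M = mat 1" by (simp add: matrix_left_right_inverse)
  have "matrix_inv ?M = ?N"
  proof -
    have "?M ** matrix_inv ?M = mat 1"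
      using someI_ex[of "\<lambda>X. ?M ** X = mat 1 \<and> X ** ?M = mat 1"] MN \<open>?N ** ?M = mat 1\<close>
      by (auto simp: matrix_inv_def)
    then show ?thesis
      using \<open>?N ** ?M = mat 1\<close> by (metis matrix_mul_assoc matrix_mul_lid matrix_mul_rid)
  qed
  then show ?thesis by (simp add: rk_gamma_def E_def B_def t_def cm)
qed

text \<open>On \<open>- \<real>\<^sub>\<le>\<^sub>0\<close>, \<^const>\<open>powr\<close> is the principal branch.\<close>

definition cq_kernel :: "real \<Rightarrow> complex \<Rightarrow> complex" where
  "cq_kernel \<beta> s = s powr (- of_real \<beta>)"

definition cq_weight :: "real^'r^'r \<Rightarrow> real^'r \<Rightarrow> real \<Rightarrow> real \<Rightarrow> nat \<Rightarrow> real^'r^'r" where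
  "cq_weight A b h \<beta> = (THE W. \<exists>\<rho>>0. \<forall>z\<in>ball 0 \<rho>.
     (\<lambda>n. map_matrix ((*) (z ^ n)) (cmat (W n))) sums
       hol_calc (- \<real>\<^sub>\<le>\<^sub>0) (cq_kernel \<beta>) (rk_gamma A b z /\<^sub>R h))"

definition retarded_cq ::
    "real^'r^'r \<Rightarrow> real^'r \<Rightarrow> real \<Rightarrow> real \<Rightarrow> (nat \<Rightarrow> real^'r) \<Rightarrow> nat \<Rightarrow> real^'r" where
  "retarded_cq A b h \<beta> f k = (\<Sum>n=0..k. cq_weight A b h \<beta> (k - n) *v f n)"

text \<open>\<^term>\<open>N\<close> is the last index of the sequence; only \<open>f\<^sub>0, \<dots>, f\<^sub>N\<close> enter when \<^term>\<open>k \<le> N\<close>.\<close>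

definition advanced_cq ::
    "real^'r^'r \<Rightarrow> real^'r \<Rightarrow> real \<Rightarrow> nat \<Rightarrow> real \<Rightarrow> (nat \<Rightarrow> real^'r) \<Rightarrow> nat \<Rightarrow> real^'r" where
  "advanced_cq A b h N \<beta> f k = (\<Sum>n=0..N - k. transpose (cq_weight A b h \<beta> n) *v f (k + n))"

end

theory Submission
  imports Defs "HOL-Computational_Algebra.Fundamental_Theorem_Algebra"
begin

text \<open>
  Integration by parts, and the step from the weights to the semigroup property, are rearrangements of finite double sums.
  The content of the theorem is the identity \<open>W\<^sup>(\<^sup>2\<^sup>\<alpha>\<^sup>) = W\<^sup>(\<^sup>\<alpha>\<^sup>) * W\<^sup>(\<^sup>\<alpha>\<^sup>)\<close> (Cauchy product of
  sequences of matrices), proved as \<open>cq_weight_double\<close>. It holds because \<open>s\<^sup>-\<^sup>2\<^sup>\<alpha> = s\<^sup>-\<^sup>\<alpha> s\<^sup>-\<^sup>\<alpha>\<close>, because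
  the holomorphic functional calculus is multiplicative, and because the coefficients of a
  convergent power series are unique. Since the calculus and the weights are specified by definite
  descriptions, they must also be shown to exist: the Dunford integral must not depend on the cycle,
  and \<open>K(\<gamma>(z)/h)\<close> must be analytic at \<open>z = 0\<close> with real Taylor coefficients.

  Independence of the cycle and multiplicativity come from one formula. Write
  \<open>D(f)\<close> for the Dunford integral of \<open>f\<close> at \<open>M\<close> over a fixed cycle. From \<open>s (s - M)\<inverse> = I + M (s - M)\<inverse>\<close>
  and Cauchy's theorem, \<open>D((s - a) f) = (M - a) D(f)\<close> for \<open>f\<close> holomorphic on a
  simply connected \<open>U\<close> that contains the spectrum of \<open>M\<close>. Splitting
  \<open>f(s) = f(a) + (s - a) f\<^sub>1(s)\<close> again and again, with \<open>a\<close> running through a list of eigenvalues,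
  gives Newton interpolation at the level of matrices (\<open>dunford_newton\<close>):
  \<open>D(f g) = P D(g) + (\<Prod>(M - a\<^sub>i)) D(q g)\<close>, where \<open>P\<close> is a polynomial in \<open>M\<close> that is computed from
  \<open>f\<close> and the list alone. For a suitable list the product \<open>\<Prod>(M - a\<^sub>i)\<close> vanishes
  (\<open>ex_annihilating_shifts\<close>). Then \<open>D(f g) = P D(g)\<close>, and \<open>g = 1\<close> with \<open>D(1) = I\<close>
  (\<open>dunford_one\<close>, by partial fractions) identifies \<open>P\<close> as \<open>D(f)\<close>; so \<open>D\<close> is multiplicative, and
  its value does not depend on the cycle. The same formula is visibly compatible with complex
  conjugation (\<open>hol_calc_cnj\<close>), which makes the Taylor coefficients real.

  For analyticity (\<open>hol_calc_holomorphic\<close>), small circles about the eigenvalues of \<open>M(z\<^sub>0)\<close> also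
  enclose the spectrum of \<open>M(z)\<close> for \<open>z\<close> near \<open>z\<^sub>0\<close>, so that one fixed cycle can be used and one may
  differentiate under the integral.
\<close>

section \<open>Matrices, eigenvalues and annihilating products\<close>

lemma mat_mult_matrix: "mat c ** X = (\<chi> i j. c * X $ i $ j)"
  for X :: "'a::semiring_1^'n^'m"
  by (simp add: vec_eq_iff matrix_matrix_mult_def mat_def if_distrib[of "\<lambda>x. x * _"] cong: if_cong)

lemma mat_commute: "X ** mat c = mat c ** (X :: 'a::comm_semiring_1^'n^'m)"
  by (simp add: vec_eq_iff matrix_matrix_mult_def mat_def if_distrib[of "\<lambda>x. x * _"]
      if_distrib[of "\<lambda>x. _ * x"] mult.commute cong: if_cong)

lemma mat_mult_vector: "mat c *v v = c *s (v :: 'a::semiring_1^'n)"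
  by (simp add: vec_eq_iff matrix_vector_mult_def mat_def vector_scalar_mult_def
      if_distrib[of "\<lambda>x. x * _"] cong: if_cong)

lemma mat_add: "mat (a + b) = mat a + (mat b :: 'a::monoid_add^'n^'n)"
  by (simp add: vec_eq_iff mat_def)

lemma mat_times: "mat (a * b) = mat a ** (mat b :: 'a::semiring_1^'n^'n)"
  by (simp add: mat_mult_matrix) (simp add: vec_eq_iff mat_def)

lemma matrix_diff_ldistrib: "X ** (Y - Z) = X ** Y - X ** (Z :: 'a::ring_1^'n^'m)"
  by (simp add: vec_eq_iff matrix_matrix_mult_def algebra_simps sum_subtractf)

lemma matrix_diff_rdistrib: "(Y - Z) ** X = Y ** X - (Z :: 'a::ring_1^'n^'m) ** X"
  by (simp add: vec_eq_iff matrix_matrix_mult_def algebra_simps sum_subtractf)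

lemma matrix_add_rdistrib: "(Y + Z) ** X = Y ** X + (Z :: 'a::semiring_1^'n^'m) ** X"
  by (simp add: vec_eq_iff matrix_matrix_mult_def algebra_simps sum.distrib)

lemma matrix_inv_cancel:
  assumes "invertible (X :: 'a::semiring_1^'n^'m)"
  shows "X ** matrix_inv X = mat 1" "matrix_inv X ** X = mat 1"
  using someI_ex[OF assms[unfolded invertible_def]] by (simp_all add: matrix_inv_def)

lemma matrix_inv_eqI:
  assumes "X ** Y = mat 1"
  shows "matrix_inv X = (Y :: 'a::field^'n^'n)"
proof -
  have "invertible X" using assms invertible_right_inverse by blast
  then show ?thesis
    by (metis assms matrix_inv_cancel(2) matrix_mul_assoc matrix_mul_lid matrix_mul_rid)
qed

lemma notin_spectrum_iff: "s \<notin> spectrum M \<longleftrightarrow> invertible (mat s - M)"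
proof -
  have "invertible (mat s - M) \<longleftrightarrow> (\<forall>v. (mat s - M) *v v = 0 \<longrightarrow> v = 0)"
    by (simp add: invertible_left_inverse matrix_left_invertible_ker)
  then show ?thesis
    by (auto simp: spectrum_def matrix_vector_mult_diff_rdistrib mat_mult_vector)
qed

text \<open>The factors are kept as a list of shifts, since Newton interpolation consumes them one at a time.\<close>

primrec shift_prod :: "complex list \<Rightarrow> complex^'n^'n \<Rightarrow> complex^'n^'n" where
  "shift_prod [] M = mat 1"
| "shift_prod (a # as) M = (M - mat a) ** shift_prod as M"

lemma shift_prod_eigenvector:
  assumes "M *v v = s *s v"
  shows "shift_prod as M *v v = (\<Prod>a\<leftarrow>as. s - a) *s v"
proof (induction as)
  case (Cons a as)
  have "shift_prod (a # as) M *v v = (M - mat a) *v ((\<Prod>a\<leftarrow>as. s - a) *s v)"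
    by (simp flip: matrix_vector_mul_assoc add: Cons)
  also have "\<dots> = (\<Prod>a\<leftarrow>as. s - a) *s ((M - mat a) *v v)"
    by (simp add: vec_eq_iff matrix_vector_mult_def sum_distrib_left mult_ac)
  also have "(M - mat a) *v v = (s - a) *s v"
    by (simp add: matrix_vector_mult_diff_rdistrib mat_mult_vector assms vector_sub_rdistrib)
  finally show ?case by (simp add: vec_eq_iff algebra_simps)
qed simp

text \<open>Horner evaluation of a polynomial at a matrix.\<close>

definition poly_mat :: "complex poly \<Rightarrow> complex^'n^'n \<Rightarrow> complex^'n^'n" where
  "poly_mat p M = fold_coeffs (\<lambda>a X. mat a + M ** X) p 0"

lemma poly_mat_0 [simp]: "poly_mat 0 M = 0"
  by (simp add: poly_mat_def)

lemma poly_mat_pCons [simp]: "poly_mat (pCons a p) M = mat a + M ** poly_mat p M"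
  by (cases "p = 0 \<and> a = 0") (auto simp: poly_mat_def)

lemma poly_mat_add: "poly_mat (p + q) M = poly_mat p M + poly_mat q M"
  by (induction p q rule: poly_induct2) (simp_all add: mat_add matrix_add_ldistrib)

lemma poly_mat_smult: "poly_mat (smult c p) M = mat c ** poly_mat p M"
  by (induction p)
    (simp_all add: mat_times matrix_add_ldistrib matrix_mul_assoc flip: mat_commute[of M])

lemma poly_mat_linear_mult: "poly_mat ([:- a, 1:] * p) M = (M - mat a) ** poly_mat p M"
proof -
  have "[:- a, 1:] * p = pCons 0 p + smult (- a) p"
    by (simp add: mult_pCons_left)
  moreover have "mat (- a) ** poly_mat p M = - (mat a ** poly_mat p M)"
    by (simp add: mat_mult_matrix vec_eq_iff)
  ultimately show ?thesis
    by (simp only: poly_mat_add poly_mat_smult poly_mat_pCons matrix_diff_rdistrib)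
      simp
qed

lemma poly_mat_sum: "poly_mat (\<Sum>k\<in>K. f k) M = (\<Sum>k\<in>K. poly_mat (f k) M)"
  by (induction K rule: infinite_finite_induct) (simp_all add: poly_mat_add)

text \<open>The matrices form a space of finite dimension over the reals, hence the powers of \<open>M\<close> satisfy a
  linear relation with real coefficients.\<close>

lemma ex_annihilating_poly:
  fixes M :: "complex^'n^'n"
  shows "\<exists>p. p \<noteq> 0 \<and> poly_mat p M = 0"
proof -
  define X where "X k = poly_mat (monom 1 k) M" for k
  have Xr: "poly_mat (monom (of_real c) k) M = c *\<^sub>R X k" for c k
  proof -
    have "monom (of_real c) k = smult (of_real c) (monom 1 k :: complex poly)"
      by (simp add: smult_monom)
    then have "poly_mat (monom (of_real c) k) M = mat (of_real c) ** X k"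
      by (simp only: X_def poly_mat_smult)
    then show ?thesis
      by (simp add: mat_mult_matrix vec_eq_iff scaleR_conv_of_real[symmetric])
  qed
  define d where "d = DIM(complex^'n^'n)"
  show ?thesis
  proof (cases "inj_on X {..d}")
    case True
    then have "card (X ` {..d}) = Suc d" by (simp add: card_image)
    then have "dependent (X ` {..d})"
      using independent_bound[of "X ` {..d}"] by (auto simp: d_def)
    then obtain u where u: "\<exists>v\<in>X ` {..d}. u v \<noteq> 0" "(\<Sum>v\<in>X ` {..d}. u v *\<^sub>R v) = 0"
      using dependent_finite[of "X ` {..d}"] by auto
    define p where "p = (\<Sum>k\<le>d. monom (complex_of_real (u (X k))) k)"
    have "poly_mat p M = (\<Sum>k\<le>d. u (X k) *\<^sub>R X k)"
      by (simp add: p_def poly_mat_sum Xr)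
    also have "\<dots> = 0"
      using u(2) True by (simp add: sum.reindex)
    finally have "poly_mat p M = 0" .
    moreover obtain k where k: "k \<le> d" "u (X k) \<noteq> 0" using u(1) by auto
    have "coeff p k = of_real (u (X k))"
      using k by (simp add: p_def coeff_sum coeff_monom if_distrib cong: if_cong)
    then have "p \<noteq> 0" using k by auto
    ultimately show ?thesis by blast
  next
    case False
    then obtain i j where ij: "i \<noteq> j" "X i = X j" by (auto simp: inj_on_def)
    define p :: "complex poly" where "p = monom 1 i + monom (of_real (-1)) j"
    have "coeff p i = 1" using ij by (simp add: p_def)
    then have "p \<noteq> 0" by auto
    moreover have "poly_mat p M = 0"
      unfolding p_def poly_mat_add Xr using ij by (simp add: X_def)
    ultimately show ?thesis by blast
  qed
qed

text \<open>An annihilating polynomial splits into linear factors. A factor \<open>M - a\<close> with \<open>a\<close> not an eigenvalue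
  is invertible and may be cancelled; what remains only involves eigenvalues, and each eigenvalue
  occurs because it is a root of every annihilating polynomial.\<close>

lemma ex_annihilating_shifts:
  fixes M :: "complex^'n^'n"
  obtains as where "set as = spectrum M" "shift_prod as M = 0"
proof -
  obtain p where p: "p \<noteq> 0" "poly_mat p M = 0" using ex_annihilating_poly by blast
  obtain B where B: "p = smult (lead_coeff p) (\<Prod>x\<in>#B. [:-x, 1:])"
    using alg_closed_imp_factorization[OF p(1)] by blast
  obtain bs where bs: "mset bs = B" using ex_mset by blast
  have *: "poly_mat (prod_list (map (\<lambda>x. [:-x, 1:]) xs)) M = shift_prod xs M" for xs
  proof (induction xs)
    case Nil
    then show ?case by (simp add: one_pCons)
  qed (simp only: list.map prod_list.Cons poly_mat_linear_mult shift_prod.simps)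
  have "p = smult (lead_coeff p) (prod_list (map (\<lambda>x. [:-x, 1:]) bs))"
    using B bs by (metis mset_map prod_mset_prod_list)
  then have "mat (lead_coeff p) ** shift_prod bs M = 0"
    using p(2) by (metis poly_mat_smult *)
  then have 0: "shift_prod bs M = 0"
    using p(1) by (simp add: mat_mult_matrix vec_eq_iff)
  have spec: "spectrum M \<subseteq> set bs"
  proof
    fix s assume "s \<in> spectrum M"
    then obtain v where v: "v \<noteq> 0" "M *v v = s *s v" by (auto simp: spectrum_def)
    then have "(\<Prod>a\<leftarrow>bs. s - a) *s v = 0"
      using shift_prod_eigenvector[OF v(2), of bs] 0 by simp
    then show "s \<in> set bs" using v(1) by (auto simp: prod_list_zero_iff)
  qed
  have "shift_prod (filter (\<lambda>a. a \<in> spectrum M) xs) M = 0"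
    if "shift_prod xs M = 0" for xs
  proof -
    \<comment> \<open>\<open>Y\<close> collects the inverses of the cancelled factors; it commutes with \<open>M\<close>, so that it can be
      moved past the factors that are kept.\<close>
    have "\<exists>Y. Y ** M = M ** Y \<and>
        shift_prod (filter (\<lambda>a. a \<in> spectrum M) xs) M = Y ** shift_prod xs M"
    proof (induction xs)
      case Nil
      show ?case by (auto intro: exI[of _ "mat 1"])
    next
      case (Cons a xs)
      then obtain Y where Y: "Y ** M = M ** Y"
        "shift_prod (filter (\<lambda>a. a \<in> spectrum M) xs) M = Y ** shift_prod xs M"
        by blast
      show ?case
      proof (cases "a \<in> spectrum M")
        case True
        have "(M - mat a) ** Y = Y ** (M - mat a)"
          by (simp add: matrix_diff_ldistrib matrix_diff_rdistrib Y(1) mat_commute)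
        then show ?thesis
          using True Y by (auto intro!: exI[of _ Y] simp: matrix_mul_assoc)
      next
        case False
        define Z where "Z = - matrix_inv (mat a - M)"
        have neg: "- X ** - X' = X ** X'" for X X' :: "complex^'n^'n"
          by (simp add: vec_eq_iff matrix_matrix_mult_def)
        have Z: "(M - mat a) ** Z = mat 1" "Z ** (M - mat a) = mat 1"
          using matrix_inv_cancel[of "mat a - M"] False neg[of "mat a - M" "matrix_inv (mat a - M)"]
            neg[of "matrix_inv (mat a - M)" "mat a - M"]
          by (simp_all add: notin_spectrum_iff Z_def)
        then have "Z ** M = M ** Z"
          by (simp add: matrix_diff_ldistrib matrix_diff_rdistrib mat_commute algebra_simps)
        then have "Y ** Z ** M = M ** (Y ** Z)"
          by (metis Y(1) matrix_mul_assoc)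
        moreover have "Y ** shift_prod xs M = Y ** Z ** ((M - mat a) ** shift_prod xs M)"
          by (metis Z(2) matrix_mul_assoc matrix_mul_lid)
        ultimately show ?thesis
          using False Y by (auto intro!: exI[of _ "Y ** Z"])
      qed
    qed
    then show ?thesis using that by auto
  qed
  then have "shift_prod (filter (\<lambda>a. a \<in> spectrum M) bs) M = 0" using 0 by blast
  moreover have "set (filter (\<lambda>a. a \<in> spectrum M) bs) = spectrum M" using spec by auto
  ultimately show thesis using that by blast
qed

lemma finite_spectrum: "finite (spectrum M)"
proof -
  obtain as where "set as = spectrum M" using ex_annihilating_shifts .
  then show ?thesis by (metis finite_set)
qed

section \<open>Newton interpolation and the Dunford integral\<close>

definition cycle_integral :: "(real \<Rightarrow> complex) list \<Rightarrow> (complex \<Rightarrow> complex) \<Rightarrow> complex" where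
  "cycle_integral \<Gamma> F = (\<Sum>g\<leftarrow>\<Gamma>. contour_integral g F)"

definition dunford ::
    "(real \<Rightarrow> complex) list \<Rightarrow> (complex \<Rightarrow> complex) \<Rightarrow> complex^'n^'n \<Rightarrow> complex^'n^'n" where
  "dunford \<Gamma> f M = (\<chi> i j. 1 / (2 * of_real pi * \<i>) *
     cycle_integral \<Gamma> (\<lambda>s. f s * matrix_inv (mat s - M) $ i $ j))"

text \<open>The quotient \<open>f\<^sub>1\<close> in \<open>f(s) = f(a) + (s - a) f\<^sub>1(s)\<close>, with its removable singularity filled in.\<close>

definition diff_quot :: "(complex \<Rightarrow> complex) \<Rightarrow> complex \<Rightarrow> complex \<Rightarrow> complex" where
  "diff_quot f a z = (if z = a then deriv f a else (f z - f a) / (z - a))"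

text \<open>For \<open>as = [a\<^sub>1, \<dots>, a\<^sub>n]\<close>, the Newton interpolation polynomial of \<open>f\<close> at these nodes, evaluated
  at \<open>M\<close>; \<open>newton_rem\<close> is the factor \<open>q\<close> of the interpolation error \<open>(s - a\<^sub>1) \<dots> (s - a\<^sub>n) q(s)\<close>.\<close>

primrec newton_mat ::
    "complex list \<Rightarrow> (complex \<Rightarrow> complex) \<Rightarrow> complex^'n^'n \<Rightarrow> complex^'n^'n" where
  "newton_mat [] f M = 0"
| "newton_mat (a # as) f M = mat (f a) + (M - mat a) ** newton_mat as (diff_quot f a) M"

primrec newton_rem :: "complex list \<Rightarrow> (complex \<Rightarrow> complex) \<Rightarrow> complex \<Rightarrow> complex" where
  "newton_rem [] f = f"
| "newton_rem (a # as) f = newton_rem as (diff_quot f a)"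

lemma diff_quot_holomorphic:
  "f holomorphic_on U \<Longrightarrow> open U \<Longrightarrow> diff_quot f a holomorphic_on U"
  using pole_lemma_open[of f U a] by (simp add: diff_quot_def[abs_def])

lemma diff_quot_mult: "f s = f a + (s - a) * diff_quot f a s"
  by (simp add: diff_quot_def)

text \<open>Cramer's rule; it makes continuity and holomorphy pass from a matrix to its inverse.\<close>

lemma matrix_inv_entry:
  fixes X :: "complex^'n^'n"
  assumes "det X \<noteq> 0"
  shows "matrix_inv X $ i $ j = det (\<chi> k l. if l = i then axis j 1 $ k else X $ k $ l) / det X"
proof -
  have "X *v (matrix_inv X *v axis j 1) = axis j 1"
    using assms by (simp add: matrix_vector_mul_assoc matrix_inv_cancel invertible_det_nz)
  then have "matrix_inv X *v axis j 1 =
      (\<chi> i. det (\<chi> k l. if l = i then axis j 1 $ k else X $ k $ l) / det X)"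
    using cramer[OF assms] by simp
  moreover have "(matrix_inv X *v axis j 1) $ i = matrix_inv X $ i $ j"
    by (simp add: matrix_vector_mult_def axis_def if_distrib cong: if_cong)
  ultimately show ?thesis by simp
qed

lemma holomorphic_on_det:
  assumes "\<And>i j. (\<lambda>z. X z $ i $ j) holomorphic_on S"
  shows "(\<lambda>z. det (X z :: complex^'n^'n)) holomorphic_on S"
  unfolding det_def by (intro holomorphic_intros assms)

lemma holomorphic_on_matrix_inv:
  fixes X :: "complex \<Rightarrow> complex^'n^'n"
  assumes "\<And>i j. (\<lambda>z. X z $ i $ j) holomorphic_on S" "\<And>z. z \<in> S \<Longrightarrow> invertible (X z)"
  shows "(\<lambda>z. matrix_inv (X z) $ i $ j) holomorphic_on S"
proof -
  have nz: "det (X z) \<noteq> 0" if "z \<in> S" for z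
    using assms(2)[OF that] by (simp add: invertible_det_nz)
  have "(\<lambda>z. det (\<chi> k l. if l = i then axis j 1 $ k else X z $ k $ l) / det (X z)) holomorphic_on S"
  proof (intro holomorphic_on_divide holomorphic_on_det assms nz)
    show "(\<lambda>z. (\<chi> k l. if l = i then axis j 1 $ k else X z $ k $ l) $ k $ l) holomorphic_on S" for k l
      by (cases "l = i") (simp_all add: assms)
  qed auto
  then show ?thesis
    by (rule holomorphic_transform) (simp add: matrix_inv_entry nz)
qed

lemma resolvent_holomorphic:
  "(\<lambda>s. matrix_inv (mat s - M) $ i $ j) holomorphic_on - spectrum M"
proof (rule holomorphic_on_matrix_inv)
  show "(\<lambda>s. (mat s - M) $ i $ j) holomorphic_on - spectrum M" for i j
    by (cases "i = j") (auto simp: mat_def intro!: holomorphic_intros)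
qed (simp add: notin_spectrum_iff)

lemma encloses_path_in:
  assumes "encloses \<Gamma> U S" "g \<in> set \<Gamma>" "s \<in> path_image g"
  shows "s \<in> U" "s \<notin> S"
  using assms by (auto simp: encloses_def)

lemma dunford_cong:
  assumes "encloses \<Gamma> U (spectrum M)" "\<And>s. s \<in> U \<Longrightarrow> f s = g s"
  shows "dunford \<Gamma> f M = dunford \<Gamma> g M"
  unfolding dunford_def cycle_integral_def
  by (intro arg_cong[where f = vec_lambda] ext arg_cong[where f = "(*) _"]
      arg_cong[where f = sum_list] map_cong refl contour_integral_eq)
    (simp add: assms(2) encloses_path_in[OF assms(1)])

text \<open>Simple connectedness of \<open>U\<close> makes Cauchy's theorem available for each path of the cycle
  separately.\<close>

locale spectral_cycle =
  fixes \<Gamma> :: "(real \<Rightarrow> complex) list" and U :: "complex set" and M :: "complex^'n^'n"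
  assumes open_dom: "open U"
    and simply: "simply_connected U"
    and spec: "spectrum M \<subseteq> U"
    and enc: "encloses \<Gamma> U (spectrum M)"
begin

lemma open_punctured: "open (U - spectrum M)"
  by (simp add: open_Diff open_dom finite_imp_closed finite_spectrum)

lemma contour_integrable_punctured:
  "F holomorphic_on U - spectrum M \<Longrightarrow> g \<in> set \<Gamma> \<Longrightarrow> F contour_integrable_on g"
  using enc contour_integrable_holomorphic_simple[OF _ open_punctured, of F g]
  by (auto simp: encloses_def)

lemma cycle_add:
  assumes "F holomorphic_on U - spectrum M" "G holomorphic_on U - spectrum M"
  shows "cycle_integral \<Gamma> (\<lambda>s. F s + G s) = cycle_integral \<Gamma> F + cycle_integral \<Gamma> G"
proof -
  have "cycle_integral \<Gamma> (\<lambda>s. F s + G s) =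
      (\<Sum>g\<leftarrow>\<Gamma>. contour_integral g F + contour_integral g G)"
    unfolding cycle_integral_def
    by (intro arg_cong[where f = sum_list] map_cong refl contour_integral_add contour_integrable_punctured assms)
  then show ?thesis by (simp add: cycle_integral_def sum_list_addf)
qed

lemma cycle_lmul:
  assumes "F holomorphic_on U - spectrum M"
  shows "cycle_integral \<Gamma> (\<lambda>s. c * F s) = c * cycle_integral \<Gamma> F"
proof -
  have "cycle_integral \<Gamma> (\<lambda>s. c * F s) = (\<Sum>g\<leftarrow>\<Gamma>. c * contour_integral g F)"
    unfolding cycle_integral_def
    by (intro arg_cong[where f = sum_list] map_cong refl contour_integral_lmul contour_integrable_punctured assms)
  then show ?thesis by (simp add: cycle_integral_def sum_list_const_mult)
qed

lemma cycle_sum: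
  assumes "finite K" "\<And>k. k \<in> K \<Longrightarrow> F k holomorphic_on U - spectrum M"
  shows "cycle_integral \<Gamma> (\<lambda>s. \<Sum>k\<in>K. F k s) = (\<Sum>k\<in>K. cycle_integral \<Gamma> (F k))"
  using assms
proof (induction K)
  case empty
  then show ?case by (simp add: cycle_integral_def)
next
  case (insert k K)
  then show ?case
    by (simp add: cycle_add[of "F k" "\<lambda>s. \<Sum>k\<in>K. F k s"] holomorphic_on_sum)
qed

lemma cycle_cong:
  assumes "\<And>s. s \<in> U - spectrum M \<Longrightarrow> F s = G s"
  shows "cycle_integral \<Gamma> F = cycle_integral \<Gamma> G"
  unfolding cycle_integral_def
  by (intro arg_cong[where f = sum_list] map_cong refl contour_integral_eq assms)
    (use encloses_path_in[OF enc] in auto)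

lemma cycle_cauchy:
  assumes "F holomorphic_on U"
  shows "cycle_integral \<Gamma> F = 0"
proof -
  have "contour_integral g F = 0" if "g \<in> set \<Gamma>" for g
    using enc that
    by (intro contour_integral_unique Cauchy_theorem_simply_connected[OF open_dom simply assms])
      (auto simp: encloses_def)
  then show ?thesis by (simp add: cycle_integral_def cong: map_cong)
qed

lemma cycle_inverse:
  assumes "a \<in> spectrum M"
  shows "cycle_integral \<Gamma> (\<lambda>s. 1 / (s - a)) = 2 * of_real pi * \<i>"
proof -
  have "cycle_integral \<Gamma> (\<lambda>s. 1 / (s - a)) = (\<Sum>g\<leftarrow>\<Gamma>. 2 * of_real pi * \<i> * winding_number g a)"
    unfolding cycle_integral_def
    by (intro arg_cong[where f = sum_list] map_cong refl contour_integral_unique)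
      (use enc assms has_contour_integral_winding_number[of _ a] in
        \<open>force simp: encloses_def mult_ac\<close>)
  then show ?thesis
    using enc assms by (simp add: encloses_def sum_list_const_mult)
qed

lemma inverse_prod_holomorphic:
  assumes "set_mset D \<subseteq> spectrum M"
  shows "(\<lambda>s. 1 / (\<Prod>c\<in>#D. s - c)) holomorphic_on U - spectrum M"
proof -
  have "(\<lambda>s. \<Prod>c\<in>#D. s - c) holomorphic_on A" for A
    by (induction D) (auto intro!: holomorphic_intros)
  then show ?thesis
    using assms by (intro holomorphic_intros) (auto simp: prod_mset_zero_iff)
qed

text \<open>Such a function decays at least like \<open>s\<^sup>-\<^sup>2\<close>, so its residues add up to zero, and the cycle weighs
  all of them equally. In terms of integrals: for \<open>a \<noteq> b\<close>,
  \<open>1 / ((s - a) (s - b)) = (1 / (s - a) - 1 / (s - b)) / (a - b)\<close> reduces the number of factors,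
  and if all factors agree, the function has a primitive.\<close>

lemma cycle_inverse_prod:
  assumes "2 \<le> size C" "set_mset C \<subseteq> spectrum M"
  shows "cycle_integral \<Gamma> (\<lambda>s. 1 / (\<Prod>c\<in>#C. s - c)) = 0"
  using assms
proof (induction "size C" arbitrary: C rule: less_induct)
  case less
  note hol = inverse_prod_holomorphic
  obtain a C1 where C1: "C = add_mset a C1"
    using less.prems(1) by (cases C) auto
  show ?case
  proof (cases "\<exists>b\<in>#C1. b \<noteq> a")
    case True
    then obtain b D where b: "b \<noteq> a" and "C1 = add_mset b D"
      by (meson multi_member_split)
    then have C: "C = add_mset a (add_mset b D)"
      using C1 by simp
    have *: "cycle_integral \<Gamma> (\<lambda>s. 1 / (\<Prod>c\<in>#add_mset a D. s - c)) =
        cycle_integral \<Gamma> (\<lambda>s. 1 / (\<Prod>c\<in>#add_mset b D. s - c))"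
    proof (cases "D = {#}")
      case True
      then show ?thesis using less.prems(2) C by (simp add: cycle_inverse)
    next
      case False
      then have "2 \<le> size (add_mset a D)" by (cases D) auto
      then show ?thesis
        using less.hyps[of "add_mset a D"] less.hyps[of "add_mset b D"] less.prems(2) C by simp
    qed
    have "cycle_integral \<Gamma> (\<lambda>s. 1 / (\<Prod>c\<in>#C. s - c)) =
        cycle_integral \<Gamma> (\<lambda>s. 1 / (a - b) * (1 / (\<Prod>c\<in>#add_mset a D. s - c)) +
          (- 1 / (a - b)) * (1 / (\<Prod>c\<in>#add_mset b D. s - c)))"
    proof (rule cycle_cong)
      fix s assume s: "s \<in> U - spectrum M"
      have "s - a \<noteq> 0" "s - b \<noteq> 0" "a - b \<noteq> 0" using s less.prems(2) C b by auto
      then have "1 / ((s - a) * (s - b)) = (1 / (s - a) - 1 / (s - b)) / (a - b)"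
        by (simp add: divide_simps)
      moreover have "1 / ((s - a) * (s - b) * q) = 1 / ((s - a) * (s - b)) * (1 / q)" for q
        by simp
      ultimately have "1 / ((s - a) * (s - b) * q) =
          (1 / (s - a) - 1 / (s - b)) / (a - b) * (1 / q)" for q
        by (simp only:)
      moreover have "(1 / x - 1 / y) / d * (1 / q) = 1 / d * (1 / (x * q)) + (- 1 / d) * (1 / (y * q))"
        for x y d q :: complex
        by (simp add: divide_inverse) (simp only: algebra_simps)
      ultimately show "1 / (\<Prod>c\<in>#C. s - c) = 1 / (a - b) * (1 / (\<Prod>c\<in>#add_mset a D. s - c)) +
          (- 1 / (a - b)) * (1 / (\<Prod>c\<in>#add_mset b D. s - c))"
        by (simp only: C mult.assoc[symmetric] image_mset_add_mset prod_mset.add_mset)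
    qed
    also have "\<dots> = 1 / (a - b) * cycle_integral \<Gamma> (\<lambda>s. 1 / (\<Prod>c\<in>#add_mset a D. s - c)) +
        (- 1 / (a - b)) * cycle_integral \<Gamma> (\<lambda>s. 1 / (\<Prod>c\<in>#add_mset b D. s - c))"
      using less.prems(2) C
      by (subst cycle_add, (intro holomorphic_on_mult holomorphic_on_const hol; simp)+)
        (subst (1 2) cycle_lmul, (intro hol; simp)+, rule refl)
    also have "\<dots> = 0" using * by simp
    finally show ?thesis .
  next
    case False
    define m where "m = size C1"
    have "\<forall>b\<in>#E. b = a \<Longrightarrow> E = replicate_mset (size E) a" for E
      by (induction E) auto
    then have "C1 = replicate_mset m a"
      using False unfolding m_def by blast
    then have C: "C = replicate_mset (Suc m) a" using C1 by simp
    have m: "m \<ge> 1" using less.prems(1) C1 m_def by simp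
    have "((\<lambda>s. 1 / (\<Prod>c\<in>#C. s - c)) has_contour_integral 0) g" if g: "g \<in> set \<Gamma>" for g
    proof (rule Cauchy_theorem_primitive)
      show "((\<lambda>s. - 1 / (of_nat m * (s - a) ^ m)) has_field_derivative 1 / (\<Prod>c\<in>#C. s - c))
          (at s within - {a})" if "s \<in> - {a}" for s
      proof -
        obtain k where k: "m = Suc k" using m by (cases m) auto
        have nz: "s - a \<noteq> 0" using that by auto
        have nm: "of_nat m \<noteq> (0::complex)" using m by simp
        have "((\<lambda>s. - 1 / (of_nat m * (s - a) ^ m)) has_field_derivative
            of_nat m * (of_nat m * (s - a) ^ (m - 1)) / (of_nat m * (s - a) ^ m)\<^sup>2) (at s within - {a})"
          using nz nm by (auto intro!: derivative_eq_intros simp: power2_eq_square)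
        also have "of_nat m * (of_nat m * (s - a) ^ (m - 1)) / (of_nat m * (s - a) ^ m)\<^sup>2 =
            1 / (s - a) ^ Suc m"
          using nz nm unfolding k by (simp add: divide_simps power2_eq_square)
        finally show ?thesis by (simp add: C)
      qed
      show "valid_path g" "pathfinish g = pathstart g" using enc g by (auto simp: encloses_def)
      show "path_image g \<subseteq> - {a}"
        using encloses_path_in[OF enc g] less.prems(2) C1 by auto
    qed
    then have "contour_integral g (\<lambda>s. 1 / (\<Prod>c\<in>#C. s - c)) = 0" if "g \<in> set \<Gamma>" for g
      using that contour_integral_unique by blast
    then show ?thesis
      by (simp add: cycle_integral_def cong: map_cong)
  qed
qed

lemma resolvent_hol: "(\<lambda>s. matrix_inv (mat s - M) $ i $ j) holomorphic_on U - spectrum M"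
  by (rule holomorphic_on_subset[OF resolvent_holomorphic]) auto

lemma dunford_add:
  assumes "f holomorphic_on U - spectrum M" "g holomorphic_on U - spectrum M"
  shows "dunford \<Gamma> (\<lambda>s. f s + g s) M = dunford \<Gamma> f M + dunford \<Gamma> g M"
  by (simp add: dunford_def vec_eq_iff distrib_right distrib_left add_divide_distrib
      cycle_add[OF holomorphic_on_mult[OF assms(1) resolvent_hol]
        holomorphic_on_mult[OF assms(2) resolvent_hol]])

lemma dunford_scale:
  assumes "f holomorphic_on U - spectrum M"
  shows "dunford \<Gamma> (\<lambda>s. c * f s) M = mat c ** dunford \<Gamma> f M"
  by (simp add: dunford_def vec_eq_iff mat_mult_matrix mult.assoc
      cycle_lmul[OF holomorphic_on_mult[OF assms resolvent_hol]])

text \<open>Integrate \<open>(s - a) (s - M)\<inverse> = I + (M - a) (s - M)\<inverse>\<close> against \<open>f\<close>. Poles of \<open>f\<close> at eigenvalues are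
  allowed here, as \<open>dunford_one\<close> applies the lemma to reciprocals of products of \<open>s - c\<close>.\<close>

lemma dunford_shift:
  assumes f: "f holomorphic_on U - spectrum M"
  shows "dunford \<Gamma> (\<lambda>s. (s - a) * f s) M =
    mat (1 / (2 * of_real pi * \<i>) * cycle_integral \<Gamma> f) + (M - mat a) ** dunford \<Gamma> f M"
proof -
  define R where "R s = matrix_inv (mat s - M)" for s
  have "cycle_integral \<Gamma> (\<lambda>s. (s - a) * f s * R s $ i $ j) =
      mat (cycle_integral \<Gamma> f) $ i $ j +
      (\<Sum>k\<in>UNIV. (M - mat a) $ i $ k * cycle_integral \<Gamma> (\<lambda>s. f s * R s $ k $ j))" for i j
  proof -
    have hol: "(\<lambda>s. f s * R s $ k $ j) holomorphic_on U - spectrum M" for k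
      unfolding R_def by (intro holomorphic_on_mult f resolvent_hol)
    have "cycle_integral \<Gamma> (\<lambda>s. (s - a) * f s * R s $ i $ j) =
        cycle_integral \<Gamma> (\<lambda>s. mat 1 $ i $ j * f s +
          (\<Sum>k\<in>UNIV. (M - mat a) $ i $ k * (f s * R s $ k $ j)))"
    proof (rule cycle_cong)
      fix s assume "s \<in> U - spectrum M"
      then have 1: "(mat s - M) ** R s = mat 1"
        by (simp add: R_def matrix_inv_cancel notin_spectrum_iff)
      have "mat (s - a) = (mat s - M) + (M - mat a)"
        by (simp add: vec_eq_iff mat_def)
      then have "mat (s - a) ** R s = mat 1 + (M - mat a) ** R s"
        by (simp only: matrix_add_rdistrib 1)
      then have "(mat (s - a) ** R s) $ i $ j = (mat 1 + (M - mat a) ** R s) $ i $ j"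
        by simp
      then have "(s - a) * R s $ i $ j =
          mat 1 $ i $ j + (\<Sum>k\<in>UNIV. (M - mat a) $ i $ k * R s $ k $ j)"
        by (simp only: mat_mult_matrix vec_lambda_beta vector_add_component
            matrix_matrix_mult_def[of "M - mat a"])
      then have "f s * ((s - a) * R s $ i $ j) =
          f s * (mat 1 $ i $ j + (\<Sum>k\<in>UNIV. (M - mat a) $ i $ k * R s $ k $ j))"
        by simp
      then show "(s - a) * f s * R s $ i $ j = mat 1 $ i $ j * f s +
          (\<Sum>k\<in>UNIV. (M - mat a) $ i $ k * (f s * R s $ k $ j))"
        by (simp only: sum_distrib_left distrib_left mult_ac)
    qed
    also have "\<dots> = cycle_integral \<Gamma> (\<lambda>s. mat 1 $ i $ j * f s) +
        cycle_integral \<Gamma> (\<lambda>s. \<Sum>k\<in>UNIV. (M - mat a) $ i $ k * (f s * R s $ k $ j))"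
      by (intro cycle_add holomorphic_on_sum holomorphic_on_mult[OF holomorphic_on_const] f hol)
    also have "\<dots> = mat 1 $ i $ j * cycle_integral \<Gamma> f +
        (\<Sum>k\<in>UNIV. cycle_integral \<Gamma> (\<lambda>s. (M - mat a) $ i $ k * (f s * R s $ k $ j)))"
      by (subst cycle_lmul[OF f], subst cycle_sum)
        (intro finite holomorphic_on_mult[OF holomorphic_on_const] hol refl)+
    also have "\<dots> = mat (cycle_integral \<Gamma> f) $ i $ j +
      (\<Sum>k\<in>UNIV. (M - mat a) $ i $ k * cycle_integral \<Gamma> (\<lambda>s. f s * R s $ k $ j))"
      using hol by (simp add: cycle_lmul del: vector_minus_component) (simp add: mat_def)
    finally show ?thesis .
  qed
  then show ?thesis
    by (simp add: vec_eq_iff dunford_def R_def matrix_matrix_mult_def mat_def sum_divide_distrib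
        add_divide_distrib cong: if_cong)
qed

lemma dunford_shift_holomorphic:
  assumes "f holomorphic_on U"
  shows "dunford \<Gamma> (\<lambda>s. (s - a) * f s) M = (M - mat a) ** dunford \<Gamma> f M"
  using dunford_shift[of f a] assms holomorphic_on_subset[OF assms, of "U - spectrum M"]
  by (simp add: cycle_cauchy)

text \<open>Partial fractions. With \<open>T(C)\<close> the Dunford integral of \<open>1 / \<Prod>(s - c)\<close> over \<open>c \<in> C\<close>, the shift rule
  expresses \<open>T(C)\<close> through \<open>(M - a) T(C + {a})\<close> and a scalar integral. That integral is \<open>2 \<pi> \<i>\<close> for
  empty \<open>C\<close> and \<open>0\<close> otherwise, so \<open>T({}) = I + (M - a) T({a})\<close>, and \<open>T({a})\<close> is divisible by an
  annihilating product, that is, zero.\<close>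

lemma dunford_one: "dunford \<Gamma> (\<lambda>_. 1) M = mat 1"
proof -
  define T where "T C = dunford \<Gamma> (\<lambda>s. 1 / (\<Prod>c\<in>#C. s - c)) M" for C
  note hol = inverse_prod_holomorphic
  have T: "T C = mat (1 / (2 * of_real pi * \<i>) *
      cycle_integral \<Gamma> (\<lambda>s. 1 / (\<Prod>c\<in>#add_mset a C. s - c))) + (M - mat a) ** T (add_mset a C)"
    if "a \<in> spectrum M" "set_mset C \<subseteq> spectrum M" for a C
  proof -
    have "T C = dunford \<Gamma> (\<lambda>s. (s - a) * (1 / (\<Prod>c\<in>#add_mset a C. s - c))) M"
      unfolding T_def dunford_def
      by (intro arg_cong[where f = vec_lambda] ext arg_cong[where f = "(*) _"] cycle_cong)
        (use that in auto)
    then show ?thesis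
      using dunford_shift[OF hol, of "add_mset a C" a] that by (simp add: T_def)
  qed
  have T_many: "T C = shift_prod as M ** T (mset as + C)"
    if "C \<noteq> {#}" "set_mset C \<subseteq> spectrum M" "set as \<subseteq> spectrum M" for C as
    using that
  proof (induction as arbitrary: C)
    case (Cons a as)
    have "2 \<le> size (add_mset a C)" using Cons.prems(1) by (cases C) auto
    then have step: "T D = (M - mat a) ** T (add_mset a D)"
      if "D \<noteq> {#}" "set_mset D \<subseteq> spectrum M" for D
      using T[of a D] Cons.prems that cycle_inverse_prod[of "add_mset a D"] by (cases D) auto
    have "T C = (M - mat a) ** T (add_mset a C)"
      using step Cons.prems by blast
    also have "T (add_mset a C) = shift_prod as M ** T (mset as + add_mset a C)"
      using Cons by (intro Cons.IH) auto
    finally show ?case by (simp add: matrix_mul_assoc)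
  qed simp
  obtain as where as: "set as = spectrum M" "shift_prod as M = 0"
    using ex_annihilating_shifts .
  have "as \<noteq> []"
    using as(2) by (auto simp: vec_eq_iff mat_def) (metis zero_neq_one)
  then obtain a where a: "a \<in> spectrum M" using as(1) by (cases as) auto
  have "T {#a#} = 0"
    using T_many[of "{#a#}" as] as a by simp
  then have "T {#} = mat 1"
    using T[of a "{#}"] a by (simp add: cycle_inverse)
  then show ?thesis by (simp add: T_def)
qed

text \<open>Each node \<open>a\<close> splits \<open>f g\<close> into \<open>f(a) g + (s - a) (f\<^sub>1 g)\<close>. Keeping \<open>g\<close> arbitrary is what yields
  multiplicativity.\<close>

lemma dunford_newton:
  assumes "f holomorphic_on U" "g holomorphic_on U"
  shows "dunford \<Gamma> (\<lambda>s. f s * g s) M = newton_mat as f M ** dunford \<Gamma> g M +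
    shift_prod as M ** dunford \<Gamma> (\<lambda>s. newton_rem as f s * g s) M"
  using assms(1)
proof (induction as arbitrary: f)
  case (Cons a as)
  define q where "q = diff_quot f a"
  have q: "q holomorphic_on U"
    unfolding q_def by (intro diff_quot_holomorphic open_dom Cons.prems)
  have "f s * g s = f a * g s + (s - a) * (q s * g s)" for s
    by (subst diff_quot_mult[of f s a]) (simp add: q_def algebra_simps)
  then have "dunford \<Gamma> (\<lambda>s. f s * g s) M =
      dunford \<Gamma> (\<lambda>s. f a * g s + (s - a) * (q s * g s)) M" by presburger
  also have "\<dots> = mat (f a) ** dunford \<Gamma> g M + (M - mat a) ** dunford \<Gamma> (\<lambda>s. q s * g s) M"
  proof -
    have qg: "(\<lambda>s. q s * g s) holomorphic_on U"
      by (intro holomorphic_on_mult q assms(2))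
    have sub: "F holomorphic_on U - spectrum M" if "F holomorphic_on U" for F
      using that by (rule holomorphic_on_subset) auto
    have "(\<lambda>s. (s - a) * (q s * g s)) holomorphic_on U" "(\<lambda>s. f a * g s) holomorphic_on U"
      using qg assms(2) by (auto intro!: holomorphic_on_mult holomorphic_intros)
    then show ?thesis
      by (simp only: dunford_add sub dunford_scale[OF sub[OF assms(2)]]
          dunford_shift_holomorphic[OF qg])
  qed
  also have "dunford \<Gamma> (\<lambda>s. q s * g s) M = newton_mat as q M ** dunford \<Gamma> g M +
    shift_prod as M ** dunford \<Gamma> (\<lambda>s. newton_rem as q s * g s) M"
    by (rule Cons.IH[OF q])
  finally show ?case
    by (simp add: q_def matrix_add_ldistrib matrix_add_rdistrib matrix_mul_assoc)
qed simp

lemma dunford_eq_newton: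
  assumes "f holomorphic_on U" "shift_prod as M = 0"
  shows "dunford \<Gamma> f M = newton_mat as f M"
  using dunford_newton[OF assms(1), of "\<lambda>_. 1" as] assms(2) by (simp add: dunford_one)

text \<open>For an annihilating list, \<open>D(f g) = P D(g)\<close> where \<open>P\<close> is the Newton polynomial of \<open>f\<close> at \<open>M\<close>, and
  this matrix is \<open>D(f)\<close>.\<close>

lemma dunford_mult:
  assumes "f holomorphic_on U" "g holomorphic_on U"
  shows "dunford \<Gamma> (\<lambda>s. f s * g s) M = dunford \<Gamma> f M ** dunford \<Gamma> g M"
proof -
  obtain as where "shift_prod as M = 0" using ex_annihilating_shifts by blast
  then show ?thesis
    using dunford_newton[OF assms, of as] dunford_eq_newton[OF assms(1)] by simp
qed

end

section \<open>The holomorphic functional calculus\<close>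

text \<open>The enclosed set \<open>T\<close> is left free inside the discs, since the same circles have to serve for all
  matrices near a given one.\<close>

lemma small_circles_enclose:
  assumes U: "open U" and S: "finite S" "S \<subseteq> U"
  obtains r xs where "r > 0" "\<And>T. T \<subseteq> (\<Union>a\<in>S. ball a r) \<Longrightarrow> encloses (map (\<lambda>a. circlepath a r) xs) U T"
proof -
  have "\<forall>\<^sub>F r in at_right 0. \<forall>a\<in>S. cball a r \<subseteq> U \<and> (\<forall>b\<in>S. b \<noteq> a \<longrightarrow> 2 * r < dist a b)"
  proof (intro eventually_ball_finite S ballI eventually_conj)
    fix a assume a: "a \<in> S"
    then obtain e where e: "e > 0" "cball a e \<subseteq> U"
      using U S open_contains_cball by blast
    then show "\<forall>\<^sub>F r in at_right 0. cball a r \<subseteq> U"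
      by (auto simp: eventually_at_right_field intro!: exI[of _ e])
    fix b assume "b \<in> S"
    show "\<forall>\<^sub>F r in at_right 0. b \<noteq> a \<longrightarrow> 2 * r < dist a b"
      by (cases "b = a") (auto simp: eventually_at_right_field intro!: exI[of _ "dist a b / 2"])
  qed
  then obtain e where "e > 0"
    and e: "\<And>r. 0 < r \<Longrightarrow> r < e \<Longrightarrow> \<forall>a\<in>S. cball a r \<subseteq> U \<and> (\<forall>b\<in>S. b \<noteq> a \<longrightarrow> 2 * r < dist a b)"
    by (auto simp: eventually_at_right_field)
  define r where "r = e / 2"
  have r: "r > 0" using \<open>e > 0\<close> by (simp add: r_def)
  have sub: "cball a r \<subseteq> U" if "a \<in> S" for a
    using e[of r] \<open>e > 0\<close> that by (simp add: r_def)
  have sep: "2 * r < dist a b" if "a \<in> S" "b \<in> S" "b \<noteq> a" for a b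
    using e[of r] \<open>e > 0\<close> that by (simp add: r_def)
  obtain xs where xs: "set xs = S" "distinct xs" using finite_distinct_list[OF S(1)] by blast
  have zero: "winding_number (circlepath a r) w = 0" if "w \<notin> cball a r" for a w
    using r that by (intro winding_number_zero_outside[of _ "cball a r"]) auto
  have far: "r < dist b w" if "a \<in> S" "b \<in> S" "b \<noteq> a" "w \<in> ball a r" for a b w
    using sep[OF that(1-3)] dist_triangle[of a b w] that(4) by (simp add: dist_commute)
  have "encloses (map (\<lambda>a. circlepath a r) xs) U T" if T: "T \<subseteq> (\<Union>a\<in>S. ball a r)" for T
    unfolding encloses_def
  proof (intro conjI ballI allI impI)
    fix g assume "g \<in> set (map (\<lambda>a. circlepath a r) xs)"
    then obtain b where b: "b \<in> S" "g = circlepath b r" using xs by auto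
    show "valid_path g" "pathfinish g = pathstart g" using b by simp_all
    show "path_image g \<subseteq> U - T"
    proof
      fix w assume "w \<in> path_image g"
      then have w: "dist b w = r" using b r by simp
      have "w \<notin> T"
      proof
        assume "w \<in> T"
        then obtain a where a: "a \<in> S" "w \<in> ball a r" using T by blast
        then show False using far[of a b w] w b by (cases "a = b") auto
      qed
      then show "w \<in> U - T" using sub[OF b(1)] w by auto
    qed
  next
    fix w assume "w \<in> T"
    then obtain a where a: "a \<in> S" "w \<in> ball a r" using T by blast
    have "(\<Sum>g\<leftarrow>map (\<lambda>a. circlepath a r) xs. winding_number g w) =
        (\<Sum>b\<in>S. winding_number (circlepath b r) w)"
      by (simp add: o_def sum_list_distinct_conv_sum_set xs)
    also have "\<dots> = (\<Sum>b\<in>S. if b = a then 1 else 0)"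
    proof (intro sum.cong refl)
      fix b assume "b \<in> S"
      then show "winding_number (circlepath b r) w = (if b = a then 1 else 0)"
        using a far[of a b w] zero[of w b]
        by (auto intro!: winding_number_circlepath simp: dist_norm norm_minus_commute)
    qed
    also have "\<dots> = 1" using a S by simp
    finally show "(\<Sum>g\<leftarrow>map (\<lambda>a. circlepath a r) xs. winding_number g w) = 1" .
  next
    fix w assume "w \<notin> U"
    then have "winding_number (circlepath a r) w = 0" if "a \<in> S" for a
      using zero sub[OF that] by blast
    then show "(\<Sum>g\<leftarrow>map (\<lambda>a. circlepath a r) xs. winding_number g w) = 0"
      by (simp add: o_def sum_list_distinct_conv_sum_set xs)
  qed
  then show thesis using that r by blast
qed

lemma ex_spectral_cycle:
  assumes "open U" "spectrum M \<subseteq> U"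
  shows "\<exists>\<Gamma>. encloses \<Gamma> U (spectrum M)"
proof -
  obtain r xs where "r > 0"
    and *: "\<And>T. T \<subseteq> (\<Union>a\<in>spectrum M. ball a r) \<Longrightarrow> encloses (map (\<lambda>a. circlepath a r) xs) U T"
    using small_circles_enclose[OF assms(1) finite_spectrum assms(2)] by blast
  have "spectrum M \<subseteq> (\<Union>a\<in>spectrum M. ball a r)" using \<open>r > 0\<close> by auto
  then show ?thesis using * by blast
qed

text \<open>All cycles give the Newton polynomial at a list chosen from \<open>M\<close> alone, so the description in
  \<^const>\<open>hol_calc\<close> has a unique solution.\<close>

lemma hol_calc_eq_dunford:
  assumes "open U" "simply_connected U" "spectrum M \<subseteq> U" "f holomorphic_on U"
    and "encloses \<Gamma> U (spectrum M)"
  shows "hol_calc U f M = dunford \<Gamma> f M"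
proof -
  obtain as where as: "shift_prod as M = 0" using ex_annihilating_shifts by blast
  have D: "dunford \<Delta> f M = newton_mat as f M" if "encloses \<Delta> U (spectrum M)" for \<Delta>
  proof -
    interpret spectral_cycle \<Delta> U M by unfold_locales fact+
    show ?thesis using assms(4) as by (rule dunford_eq_newton)
  qed
  have "hol_calc U f M = (THE B. \<forall>\<Delta>. encloses \<Delta> U (spectrum M) \<longrightarrow> B = dunford \<Delta> f M)"
    unfolding hol_calc_def dunford_def cycle_integral_def ..
  also have "\<dots> = dunford \<Gamma> f M"
    by (rule the_equality) (use D assms(5) in \<open>auto\<close>)
  finally show ?thesis .
qed

lemma hol_calc_eq_newton:
  assumes "open U" "simply_connected U" "spectrum M \<subseteq> U" "f holomorphic_on U"
    and "shift_prod as M = 0"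
  shows "hol_calc U f M = newton_mat as f M"
proof -
  obtain \<Gamma> where \<Gamma>: "encloses \<Gamma> U (spectrum M)"
    using ex_spectral_cycle assms by blast
  interpret spectral_cycle \<Gamma> U M by unfold_locales (fact assms \<Gamma>)+
  show ?thesis
    using hol_calc_eq_dunford[OF assms(1-4) \<Gamma>] dunford_eq_newton[OF assms(4-5)] by simp
qed

lemma hol_calc_mult:
  assumes "open U" "simply_connected U" "spectrum M \<subseteq> U" "f holomorphic_on U" "g holomorphic_on U"
  shows "hol_calc U (\<lambda>s. f s * g s) M = hol_calc U f M ** hol_calc U g M"
proof -
  obtain \<Gamma> where \<Gamma>: "encloses \<Gamma> U (spectrum M)"
    using ex_spectral_cycle assms by blast
  interpret spectral_cycle \<Gamma> U M by unfold_locales (fact assms \<Gamma>)+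
  show ?thesis
    using dunford_mult[OF assms(4,5)] hol_calc_eq_dunford[OF assms(1-3) _ \<Gamma>] assms(4,5)
    by (simp add: holomorphic_on_mult)
qed

lemma hol_calc_cong:
  assumes "open U" "simply_connected U" "spectrum M \<subseteq> U" "f holomorphic_on U"
    and "\<And>s. s \<in> U \<Longrightarrow> f s = g s"
  shows "hol_calc U f M = hol_calc U g M"
proof -
  obtain \<Gamma> where \<Gamma>: "encloses \<Gamma> U (spectrum M)"
    using ex_spectral_cycle assms by blast
  have "g holomorphic_on U" using assms(4,5) holomorphic_cong by blast
  then show ?thesis
    using dunford_cong[OF \<Gamma> assms(5)] hol_calc_eq_dunford[OF assms(1-3) _ \<Gamma>] assms(4) by simp
qed

lemma map_matrix_cnj_mult:
  "map_matrix cnj (X ** Y) = map_matrix cnj X ** map_matrix cnj Y"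
  by (simp add: vec_eq_iff matrix_matrix_mult_def)

lemma map_matrix_cnj_mat: "map_matrix cnj (mat a) = mat (cnj a)"
  by (simp add: vec_eq_iff mat_def)

lemma map_matrix_cnj_add: "map_matrix cnj (X + Y) = map_matrix cnj X + map_matrix cnj Y"
  by (simp add: vec_eq_iff)

lemma map_matrix_cnj_diff: "map_matrix cnj (X - Y) = map_matrix cnj X - map_matrix cnj Y"
  by (simp add: vec_eq_iff)

lemma map_matrix_cnj_cnj: "map_matrix cnj (map_matrix cnj X) = X"
  by (simp add: vec_eq_iff)

lemma spectrum_cnj: "spectrum (map_matrix cnj M) = cnj ` spectrum M"
proof -
  have sub: "cnj ` spectrum M \<subseteq> spectrum (map_matrix cnj M)" for M :: "complex^'n^'n"
  proof clarify
    fix s assume "s \<in> spectrum M"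
    then obtain v where v: "v \<noteq> 0" "M *v v = s *s v" by (auto simp: spectrum_def)
    define w where "w = (\<chi> i. cnj (v $ i))"
    have "map_matrix cnj M *v w = (\<chi> i. cnj ((M *v v) $ i))"
      by (simp add: vec_eq_iff matrix_vector_mult_def w_def)
    then have "map_matrix cnj M *v w = cnj s *s w"
      by (simp add: v(2) vec_eq_iff w_def)
    moreover have "w \<noteq> 0" using v(1) by (simp add: w_def vec_eq_iff)
    ultimately show "cnj s \<in> spectrum (map_matrix cnj M)" by (auto simp: spectrum_def)
  qed
  have "spectrum (map_matrix cnj M) = cnj ` cnj ` spectrum (map_matrix cnj M)"
    by (simp add: image_image)
  also have "\<dots> \<subseteq> cnj ` spectrum M"
    using sub[of "map_matrix cnj M"] by (intro image_mono) (simp add: map_matrix_cnj_cnj)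
  finally show ?thesis using sub by blast
qed

lemma shift_prod_cnj:
  "shift_prod (map cnj as) (map_matrix cnj M) = map_matrix cnj (shift_prod as M)"
  by (induction as)
    (simp_all add: map_matrix_cnj_mult map_matrix_cnj_mat map_matrix_cnj_diff)

lemma diff_quot_cnj:
  assumes "f holomorphic_on U" "open U" "a \<in> U"
  shows "diff_quot (cnj \<circ> f \<circ> cnj) (cnj a) = cnj \<circ> diff_quot f a \<circ> cnj"
proof -
  have "(f has_field_derivative deriv f a) (at (cnj (cnj a)))"
    using holomorphic_derivI[OF assms] by simp
  then have "deriv (cnj \<circ> f \<circ> cnj) (cnj a) = cnj (deriv f a)"
    by (intro DERIV_imp_deriv has_field_derivative_cnj_cnj)
  then show ?thesis
    by (auto simp: fun_eq_iff diff_quot_def)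
qed

lemma newton_mat_cnj:
  assumes "f holomorphic_on U" "open U" "set as \<subseteq> U"
  shows "newton_mat (map cnj as) (cnj \<circ> f \<circ> cnj) (map_matrix cnj M) =
    map_matrix cnj (newton_mat as f M)"
  using assms(1,3)
proof (induction as arbitrary: f)
  case Nil
  then show ?case by (simp add: vec_eq_iff)
next
  case (Cons a as)
  have "newton_mat (map cnj as) (cnj \<circ> diff_quot f a \<circ> cnj) (map_matrix cnj M) =
      map_matrix cnj (newton_mat as (diff_quot f a) M)"
    using Cons.prems by (intro Cons.IH diff_quot_holomorphic assms(2)) auto
  moreover have "a \<in> U" using Cons.prems(2) by simp
  ultimately have "newton_mat (map cnj (a # as)) (cnj \<circ> f \<circ> cnj) (map_matrix cnj M) =
      mat ((cnj \<circ> f \<circ> cnj) (cnj a)) + (map_matrix cnj M - mat (cnj a)) **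
        map_matrix cnj (newton_mat as (diff_quot f a) M)"
    by (simp only: list.map newton_mat.simps diff_quot_cnj[OF Cons.prems(1) assms(2)])
  also have "\<dots> = map_matrix cnj (newton_mat (a # as) f M)"
    by (simp add: map_matrix_cnj_add map_matrix_cnj_mat map_matrix_cnj_mult map_matrix_cnj_diff)
  finally show ?case .
qed

text \<open>Conjugating the nodes, the function and the matrix conjugates the Newton polynomial; and the
  conjugated nodes annihilate the conjugated matrix.\<close>

lemma hol_calc_cnj:
  assumes U: "open U" "simply_connected U" "cnj ` U = U"
    and M: "spectrum M \<subseteq> U" and f: "f holomorphic_on U"
    and sym: "\<And>s. s \<in> U \<Longrightarrow> f (cnj s) = cnj (f s)"
  shows "hol_calc U f (map_matrix cnj M) = map_matrix cnj (hol_calc U f M)"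
proof -
  obtain as where as: "set as = spectrum M" "shift_prod as M = 0"
    using ex_annihilating_shifts .
  have spec: "spectrum (map_matrix cnj M) \<subseteq> U" using M U(3) by (auto simp: spectrum_cnj)
  have hol: "cnj \<circ> f \<circ> cnj holomorphic_on U"
    using holomorphic_on_compose_cnj_cnj[of f U] f U by simp
  have "hol_calc U f (map_matrix cnj M) = hol_calc U (cnj \<circ> f \<circ> cnj) (map_matrix cnj M)"
    by (rule hol_calc_cong[OF U(1,2) spec f]) (simp add: sym)
  also have "\<dots> = newton_mat (map cnj as) (cnj \<circ> f \<circ> cnj) (map_matrix cnj M)"
    by (rule hol_calc_eq_newton[OF U(1,2) spec hol])
      (simp add: shift_prod_cnj as vec_eq_iff)
  also have "\<dots> = map_matrix cnj (newton_mat as f M)"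
    by (rule newton_mat_cnj[OF f U(1)]) (use as M in simp)
  also have "newton_mat as f M = hol_calc U f M"
    using hol_calc_eq_newton[OF U(1,2) M f as(2)] by simp
  finally show ?thesis .
qed

section \<open>Holomorphic dependence on a parameter\<close>

lemma isCont_matrix_mult:
  fixes X Y :: "'a::t2_space \<Rightarrow> complex^'n^'n"
  assumes "\<And>i j. isCont (\<lambda>z. X z $ i $ j) z0" "\<And>i j. isCont (\<lambda>z. Y z $ i $ j) z0"
  shows "isCont (\<lambda>z. (X z ** Y z) $ i $ j) z0"
  unfolding matrix_matrix_mult_def by (simp add: continuous_intros assms)

lemma isCont_shift_prod:
  fixes M :: "'a::t2_space \<Rightarrow> complex^'n^'n"
  assumes "\<And>i j. isCont (\<lambda>z. M z $ i $ j) z0"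
  shows "isCont (\<lambda>z. shift_prod as (M z) $ i $ j) z0"
proof (induction as arbitrary: i j)
  case (Cons a as)
  show ?case
    unfolding shift_prod.simps
    by (intro isCont_matrix_mult Cons) (simp add: continuous_intros assms)
qed simp

text \<open>Compare the eigenvector equation in the coordinate where the eigenvector is largest.\<close>

lemma eigenvalue_le_sum_entries:
  fixes X :: "complex^'n^'n"
  assumes "X *v v = c *s v" "v \<noteq> 0"
  shows "norm c \<le> (\<Sum>i\<in>UNIV. \<Sum>j\<in>UNIV. norm (X $ i $ j))"
proof -
  obtain i where i: "\<And>j. norm (v $ j) \<le> norm (v $ i)"
  proof -
    have "Max (range (\<lambda>i. norm (v $ i))) \<in> range (\<lambda>i. norm (v $ i))"
      by (rule Max_in) auto
    then obtain i where "Max (range (\<lambda>i. norm (v $ i))) = norm (v $ i)" by (rule rangeE)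
    then have "norm (v $ j) \<le> norm (v $ i)" for j
      by (metis Max_ge finite finite_imageI rangeI)
    then show thesis by (rule that)
  qed
  have pos: "norm (v $ i) > 0"
  proof (rule ccontr)
    assume "\<not> norm (v $ i) > 0"
    then have "v $ j = 0" for j using i[of j] by simp
    then show False using assms(2) by (simp add: vec_eq_iff)
  qed
  have "norm c * norm (v $ i) = norm ((X *v v) $ i)"
    by (simp add: assms(1) norm_mult)
  also have "\<dots> \<le> (\<Sum>j\<in>UNIV. norm (X $ i $ j * v $ j))"
    by (simp add: matrix_vector_mult_def norm_sum)
  also have "\<dots> \<le> (\<Sum>j\<in>UNIV. norm (X $ i $ j) * norm (v $ i))"
    by (intro sum_mono) (simp add: norm_mult mult_left_mono i)
  also have "\<dots> = (\<Sum>j\<in>UNIV. norm (X $ i $ j)) * norm (v $ i)"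
    by (simp add: sum_distrib_right)
  finally have "norm c \<le> (\<Sum>j\<in>UNIV. norm (X $ i $ j))" using pos by simp
  also have "\<dots> \<le> (\<Sum>i\<in>UNIV. \<Sum>j\<in>UNIV. norm (X $ i $ j))"
    by (rule member_le_sum[of i UNIV "\<lambda>i. \<Sum>j\<in>UNIV. norm (X $ i $ j)"]) (auto intro: sum_nonneg)
  finally show ?thesis .
qed

text \<open>Upper semicontinuity of the spectrum. If \<open>\<Prod>(M(z\<^sub>0) - a\<^sub>i) = 0\<close>, then \<open>\<Prod>(M(z) - a\<^sub>i)\<close> is small for \<open>z\<close>
  near \<open>z\<^sub>0\<close>. It has the eigenvalue \<open>\<Prod>(s - a\<^sub>i)\<close> for each eigenvalue \<open>s\<close> of \<open>M(z)\<close>, so one of the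
  factors \<open>s - a\<^sub>i\<close> is small.\<close>

lemma eventually_spectrum_near:
  fixes M :: "'a::t2_space \<Rightarrow> complex^'n^'n"
  assumes cont: "\<And>i j. isCont (\<lambda>z. M z $ i $ j) z0" and r: "r > 0"
  shows "\<forall>\<^sub>F z in nhds z0. spectrum (M z) \<subseteq> (\<Union>a\<in>spectrum (M z0). ball a r)"
proof -
  obtain as where as: "set as = spectrum (M z0)" "shift_prod as (M z0) = 0"
    using ex_annihilating_shifts .
  define e where "e z = (\<Sum>i\<in>UNIV. \<Sum>j\<in>UNIV. norm (shift_prod as (M z) $ i $ j))" for z
  have "isCont e z0"
    unfolding e_def[abs_def] by (intro continuous_intros isCont_shift_prod cont)
  moreover have "e z0 = 0" by (simp add: e_def as)
  ultimately have "(e \<longlongrightarrow> 0) (nhds z0)"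
    by (metis isContD tendsto_at_iff_tendsto_nhds)
  then have "\<forall>\<^sub>F z in nhds z0. e z < r ^ length as"
    using r by (auto dest: order_tendstoD(2)[of _ 0 _ "r ^ length as"])
  then show ?thesis
  proof eventually_elim
    case (elim z)
    show ?case
    proof
      fix s assume "s \<in> spectrum (M z)"
      then obtain v where v: "v \<noteq> 0" "M z *v v = s *s v" by (auto simp: spectrum_def)
      have "norm (\<Prod>a\<leftarrow>as. s - a) \<le> e z"
        unfolding e_def by (rule eigenvalue_le_sum_entries[OF shift_prod_eigenvector[OF v(2)] v(1)])
      then have small: "norm (\<Prod>a\<leftarrow>as. s - a) < r ^ length as" using elim by simp
      have "r ^ length xs \<le> norm (\<Prod>a\<leftarrow>xs. s - a)" if "\<forall>a\<in>set xs. r \<le> norm (s - a)" for xs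
        using that r by (induction xs) (auto simp: norm_mult intro!: mult_mono)
      then obtain a where "a \<in> set as" "norm (s - a) < r"
        using small by (meson not_le)
      then show "s \<in> (\<Union>a\<in>spectrum (M z0). ball a r)"
        using as by (auto simp: dist_norm norm_minus_commute)
    qed
  qed
qed

lemma continuous_on_det:
  assumes "\<And>i j. continuous_on S (\<lambda>z. X z $ i $ j)"
  shows "continuous_on S (\<lambda>z. det (X z :: complex^'n^'n))"
  unfolding det_def by (intro continuous_intros assms)

lemma continuous_on_matrix_inv:
  fixes X :: "'a::topological_space \<Rightarrow> complex^'n^'n"
  assumes "\<And>i j. continuous_on S (\<lambda>z. X z $ i $ j)" "\<And>z. z \<in> S \<Longrightarrow> invertible (X z)"
  shows "continuous_on S (\<lambda>z. matrix_inv (X z) $ i $ j)"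
proof -
  have nz: "det (X z) \<noteq> 0" if "z \<in> S" for z
    using assms(2)[OF that] by (simp add: invertible_det_nz)
  have "continuous_on S (\<lambda>z. det (\<chi> k l. if l = i then axis j 1 $ k else X z $ k $ l) / det (X z))"
  proof (intro continuous_on_divide continuous_on_det assms ballI nz)
    show "continuous_on S (\<lambda>z. (\<chi> k l. if l = i then axis j 1 $ k else X z $ k $ l) $ k $ l)" for k l
      by (cases "l = i") (simp_all add: assms)
  qed
  then show ?thesis
    by (rule continuous_on_eq) (simp add: matrix_inv_entry nz)
qed

lemma continuous_on_matrix_mult:
  fixes X Y :: "'a::topological_space \<Rightarrow> complex^'n^'n"
  assumes "\<And>i j. continuous_on S (\<lambda>z. X z $ i $ j)" "\<And>i j. continuous_on S (\<lambda>z. Y z $ i $ j)"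
  shows "continuous_on S (\<lambda>z. (X z ** Y z) $ i $ j)"
  unfolding matrix_matrix_mult_def by (simp add: continuous_intros assms)

text \<open>Differentiate \<open>(s - M(z)) (s - M(z))\<inverse> = I\<close>. The closed form of the derivative is needed because it
  is visibly continuous in \<open>s\<close> and \<open>z\<close> jointly.\<close>

lemma has_field_derivative_resolvent:
  fixes M :: "complex \<Rightarrow> complex^'n^'n"
  assumes B: "open B" "z \<in> B" and M: "\<And>i j. (\<lambda>z. M z $ i $ j) holomorphic_on B"
    and inv: "\<And>z. z \<in> B \<Longrightarrow> s \<notin> spectrum (M z)"
  shows "((\<lambda>z. matrix_inv (mat s - M z) $ i $ j) has_field_derivative
    (matrix_inv (mat s - M z) ** (\<chi> i j. deriv (\<lambda>z. M z $ i $ j) z) ** matrix_inv (mat s - M z))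
      $ i $ j) (at z)"
proof -
  define X where "X z = mat s - M z" for z
  define R where "R z = matrix_inv (X z)" for z
  define M' where "M' = (\<chi> i j. deriv (\<lambda>z. M z $ i $ j) z)"
  define R' where "R' = (\<chi> i j. deriv (\<lambda>z. R z $ i $ j) z)"
  have X_hol: "(\<lambda>z. X z $ i $ j) holomorphic_on B" for i j
    unfolding X_def by (simp, intro holomorphic_intros M)
  have inv_X: "invertible (X z)" if "z \<in> B" for z
    using inv[OF that] by (simp add: X_def notin_spectrum_iff)
  have R_hol: "(\<lambda>z. R z $ i $ j) holomorphic_on B" for i j
    unfolding R_def by (intro holomorphic_on_matrix_inv X_hol inv_X)
  have dM: "((\<lambda>z. M z $ i $ j) has_field_derivative M' $ i $ j) (at z)" for i j
    using holomorphic_derivI[OF M B] by (simp add: M'_def)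
  have dX: "((\<lambda>z. X z $ i $ j) has_field_derivative - M' $ i $ j) (at z)" for i j
    unfolding X_def using DERIV_diff[OF DERIV_const dM] by simp
  have dR: "((\<lambda>z. R z $ i $ j) has_field_derivative R' $ i $ j) (at z)" for i j
    using holomorphic_derivI[OF R_hol B] by (simp add: R'_def)
  have XR: "X z ** R z = mat 1" "R z ** X z = mat 1" if "z \<in> B" for z
    unfolding R_def using matrix_inv_cancel[OF inv_X[OF that]] by auto
  have "(X z ** R' - M' ** R z) $ i $ j = 0" for i j
  proof -
    have "((\<lambda>z. \<Sum>k\<in>UNIV. X z $ i $ k * R z $ k $ j) has_field_derivative
        (\<Sum>k\<in>UNIV. - M' $ i $ k * R z $ k $ j + R' $ k $ j * X z $ i $ k)) (at z)"
      by (intro DERIV_sum DERIV_mult dX dR)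
    moreover have "(\<Sum>k\<in>UNIV. X w $ i $ k * R w $ k $ j) = mat 1 $ i $ j" if "w \<in> B" for w
      using XR(1)[OF that] by (simp add: vec_eq_iff matrix_matrix_mult_def)
    ultimately have "((\<lambda>z. mat 1 $ i $ j) has_field_derivative
        (\<Sum>k\<in>UNIV. - M' $ i $ k * R z $ k $ j + R' $ k $ j * X z $ i $ k)) (at z)"
      by (rule has_field_derivative_transform_within_open[OF _ B])
    then have "(\<Sum>k\<in>UNIV. - M' $ i $ k * R z $ k $ j + R' $ k $ j * X z $ i $ k) = 0"
      using DERIV_unique DERIV_const by blast
    then show ?thesis
      by (simp add: matrix_matrix_mult_def sum.distrib sum_negf sum_subtractf mult.commute)
  qed
  then have "X z ** R' = M' ** R z" by (simp add: vec_eq_iff)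
  then have "R z ** M' ** R z = R z ** (X z ** R')" by (simp add: matrix_mul_assoc)
  also have "\<dots> = R'" by (simp add: matrix_mul_assoc XR B)
  finally show ?thesis
    using dR[of i j] by (simp add: R_def X_def M'_def)
qed

text \<open>Leibniz rule in the circle's parametrisation, where the domain of integration is a fixed interval.\<close>

lemma circle_resolvent_integral_holomorphic:
  fixes M :: "complex \<Rightarrow> complex^'n^'n"
  assumes M: "\<And>i j. (\<lambda>z. M z $ i $ j) holomorphic_on ball z0 \<rho>"
    and inv: "\<And>z. z \<in> ball z0 \<rho> \<Longrightarrow> spectrum (M z) \<inter> path_image (circlepath a r) = {}"
    and f: "continuous_on (path_image (circlepath a r)) f"
  shows "(\<lambda>z. contour_integral (circlepath a r) (\<lambda>s. f s * matrix_inv (mat s - M z) $ i $ j))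
    holomorphic_on ball z0 \<rho>"
proof -
  define g where "g = circlepath a r"
  define R where "R z t = matrix_inv (mat (g t) - M z)" for z t
  define M' where "M' z = (\<chi> i j. deriv (\<lambda>z. M z $ i $ j) z)" for z
  define w where "w t = f (g t) * vector_derivative g (at t)" for t
  have g_in: "g t \<in> path_image g" if "t \<in> cbox 0 1" for t
    using that by (auto simp: path_image_def)
  have cont_g: "continuous_on (cbox 0 1) g"
    using valid_path_imp_path[OF valid_path_circlepath, of a r] by (simp add: g_def path_def)
  have w_cont: "continuous_on (cbox 0 1) w"
    unfolding w_def
  proof (intro continuous_on_mult)
    show "continuous_on (cbox 0 1) (\<lambda>t. f (g t))"
      by (rule continuous_on_compose2[OF f cont_g]) (use g_in in \<open>auto simp: g_def\<close>)
    show "continuous_on (cbox 0 1) (\<lambda>t. vector_derivative g (at t))"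
      unfolding g_def vector_derivative_circlepath by (intro continuous_intros)
  qed
  have M_cont: "continuous_on (ball z0 \<rho>) (\<lambda>z. M z $ i $ j)" for i j
    by (rule holomorphic_on_imp_continuous_on[OF M])
  have M'_cont: "continuous_on (ball z0 \<rho>) (\<lambda>z. M' z $ i $ j)" for i j
    unfolding M'_def using holomorphic_on_imp_continuous_on[OF holomorphic_deriv[OF M open_ball]]
    by simp
  have fst: "continuous_on (ball z0 \<rho> \<times> cbox 0 1) (\<lambda>p. F (fst p))"
    if "continuous_on (ball z0 \<rho>) F" for F :: "complex \<Rightarrow> complex"
    by (rule continuous_on_compose2[OF that continuous_on_fst[OF continuous_on_id]]) auto
  have snd: "continuous_on (ball z0 \<rho> \<times> cbox 0 1) (\<lambda>p. F (snd p))"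
    if "continuous_on (cbox 0 1) F" for F :: "real \<Rightarrow> complex"
    by (rule continuous_on_compose2[OF that continuous_on_snd[OF continuous_on_id]]) auto
  have notin: "g t \<notin> spectrum (M z)" if "z \<in> ball z0 \<rho>" "t \<in> cbox 0 1" for z t
    using inv[OF that(1)] g_in[OF that(2)] by (auto simp: g_def)
  have R_cont: "continuous_on (ball z0 \<rho> \<times> cbox 0 1) (\<lambda>p. R (fst p) (snd p) $ i $ j)" for i j
    unfolding R_def
  proof (rule continuous_on_matrix_inv)
    show "continuous_on (ball z0 \<rho> \<times> cbox 0 1) (\<lambda>p. (mat (g (snd p)) - M (fst p)) $ i $ j)" for i j
    proof -
      have "continuous_on (ball z0 \<rho> \<times> cbox 0 1)
          (\<lambda>p. (if i = j then g (snd p) else 0) - M (fst p) $ i $ j)"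
        by (cases "i = j"; simp only: if_True if_False refl; intro continuous_on_diff
          snd[OF cont_g] fst[OF M_cont] continuous_on_const)
      then show ?thesis by (simp add: mat_def)
    qed
  qed (use notin in \<open>auto simp flip: notin_spectrum_iff\<close>)
  have "(\<lambda>z. integral (cbox 0 1) (\<lambda>t. w t * R z t $ i $ j)) holomorphic_on ball z0 \<rho>"
  proof (rule leibniz_rule_holomorphic)
    show "((\<lambda>z. w t * R z t $ i $ j) has_field_derivative
        w t * (R z t ** M' z ** R z t) $ i $ j) (at z within ball z0 \<rho>)"
      if "z \<in> ball z0 \<rho>" "t \<in> cbox 0 1" for z t
      unfolding R_def M'_def
      by (rule DERIV_cmult[OF has_field_derivative_at_within[OF
            has_field_derivative_resolvent[OF open_ball that(1) M notin[OF _ that(2)]]]])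
    show "(\<lambda>t. w t * R z t $ i $ j) integrable_on cbox 0 1" if z: "z \<in> ball z0 \<rho>" for z
    proof (intro integrable_continuous continuous_on_mult w_cont)
      show "continuous_on (cbox 0 1) (\<lambda>t. R z t $ i $ j)"
      proof -
        have "continuous_on (cbox 0 1) (\<lambda>t::real. (z, t))"
          by (intro continuous_intros)
        moreover have "(\<lambda>t. (z, t)) ` cbox 0 1 \<subseteq> ball z0 \<rho> \<times> cbox (0::real) 1"
          using z by auto
        ultimately show ?thesis
          using continuous_on_compose2[OF R_cont] by fastforce
      qed
    qed
    show "continuous_on (ball z0 \<rho> \<times> cbox 0 1)
        (\<lambda>(z, t). w t * (R z t ** M' z ** R z t) $ i $ j)"
      unfolding split_def
      by (intro continuous_on_mult continuous_on_matrix_mult snd[OF w_cont] R_cont fst[OF M'_cont])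
  qed simp
  then show ?thesis
    by (simp add: contour_integral_integral g_def[symmetric] w_def R_def mult_ac)
qed

text \<open>On a small disc about \<open>z\<^sub>0\<close> the calculus is a Dunford integral over circles that do not depend
  on \<open>z\<close>.\<close>

theorem hol_calc_holomorphic:
  fixes M :: "complex \<Rightarrow> complex^'n^'n"
  assumes U: "open U" "simply_connected U" and f: "f holomorphic_on U"
    and S: "open S" "z0 \<in> S" and M: "\<And>i j. (\<lambda>z. M z $ i $ j) holomorphic_on S"
    and spec: "spectrum (M z0) \<subseteq> U"
  obtains \<rho> where "\<rho> > 0" "ball z0 \<rho> \<subseteq> S" "\<And>z. z \<in> ball z0 \<rho> \<Longrightarrow> spectrum (M z) \<subseteq> U"
    "\<And>i j. (\<lambda>z. hol_calc U f (M z) $ i $ j) holomorphic_on ball z0 \<rho>"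
proof -
  obtain r xs where "r > 0" and
    enc: "\<And>T. T \<subseteq> (\<Union>a\<in>spectrum (M z0). ball a r) \<Longrightarrow>
      encloses (map (\<lambda>a. circlepath a r) xs) U T"
    using small_circles_enclose[OF U(1) finite_spectrum spec] by blast
  define \<Gamma> where "\<Gamma> = map (\<lambda>a. circlepath a r) xs"
  have "isCont (\<lambda>z. M z $ i $ j) z0" for i j
    using holomorphic_on_imp_continuous_on[OF M] S continuous_on_eq_continuous_at by blast
  then have "\<forall>\<^sub>F z in nhds z0. spectrum (M z) \<subseteq> (\<Union>a\<in>spectrum (M z0). ball a r)"
    using \<open>r > 0\<close> by (rule eventually_spectrum_near)
  then have "\<forall>\<^sub>F z in nhds z0. z \<in> S \<and> spectrum (M z) \<subseteq> (\<Union>a\<in>spectrum (M z0). ball a r)"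
    using eventually_nhds_in_open[OF S] by eventually_elim auto
  then obtain \<rho> where \<rho>: "\<rho> > 0"
    "\<And>z. dist z z0 < \<rho> \<Longrightarrow> z \<in> S \<and> spectrum (M z) \<subseteq> (\<Union>a\<in>spectrum (M z0). ball a r)"
    by (auto simp: eventually_nhds_metric)
  have sub: "ball z0 \<rho> \<subseteq> S" using \<rho>(2) by (auto simp: dist_commute)
  have \<Gamma>: "encloses \<Gamma> U (spectrum (M z))" if "z \<in> ball z0 \<rho>" for z
    unfolding \<Gamma>_def using \<rho>(2)[of z] that by (intro enc) (auto simp: dist_commute)
  have U_in: "spectrum (M z) \<subseteq> U" if "z \<in> ball z0 \<rho>" for z
    using \<Gamma>[OF that] unfolding encloses_def by (metis subsetI zero_neq_one)
  have "(\<lambda>z. dunford \<Gamma> f (M z) $ i $ j) holomorphic_on ball z0 \<rho>" for i j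
  proof -
    have "(\<lambda>z. contour_integral (circlepath a r) (\<lambda>s. f s * matrix_inv (mat s - M z) $ i $ j))
        holomorphic_on ball z0 \<rho>" if "a \<in> set xs" for a
    proof (rule circle_resolvent_integral_holomorphic)
      show "(\<lambda>z. M z $ i $ j) holomorphic_on ball z0 \<rho>" for i j
        using M sub by (rule holomorphic_on_subset)
      show "spectrum (M z) \<inter> path_image (circlepath a r) = {}" if "z \<in> ball z0 \<rho>" for z
        using \<Gamma>[OF that] \<open>a \<in> set xs\<close> by (auto simp: encloses_def \<Gamma>_def)
      have "path_image (circlepath a r) \<subseteq> U"
        using \<Gamma>[of z0] \<rho>(1) that by (auto simp: encloses_def \<Gamma>_def)
      then show "continuous_on (path_image (circlepath a r)) f"
        using f holomorphic_on_imp_continuous_on holomorphic_on_subset by blast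
    qed
    then have "(\<lambda>z. \<Sum>a\<leftarrow>ys. contour_integral (circlepath a r)
        (\<lambda>s. f s * matrix_inv (mat s - M z) $ i $ j)) holomorphic_on ball z0 \<rho>"
      if "set ys \<subseteq> set xs" for ys
      using that by (induction ys) (auto intro!: holomorphic_intros)
    then show ?thesis
      by (auto simp: dunford_def cycle_integral_def \<Gamma>_def o_def intro!: holomorphic_intros)
  qed
  moreover have "hol_calc U f (M z) = dunford \<Gamma> f (M z)" if "z \<in> ball z0 \<rho>" for z
    using hol_calc_eq_dunford[OF U U_in[OF that] f \<Gamma>[OF that]] .
  ultimately have "(\<lambda>z. hol_calc U f (M z) $ i $ j) holomorphic_on ball z0 \<rho>" for i j
    by (metis (no_types, lifting) holomorphic_transform)
  then show thesis using that \<rho>(1) sub U_in by blast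
qed

section \<open>The convolution quadrature weights\<close>

lemma sums_matrix_iff:
  fixes X :: "nat \<Rightarrow> complex^'n^'m"
  shows "X sums L \<longleftrightarrow> (\<forall>i j. (\<lambda>n. X n $ i $ j) sums L $ i $ j)"
proof -
  have "Y \<longlonglongrightarrow> L \<longleftrightarrow> (\<forall>i j. (\<lambda>n. Y n $ i $ j) \<longlonglongrightarrow> L $ i $ j)" for Y :: "nat \<Rightarrow> complex^'n^'m"
    by (auto intro: tendsto_vec_nth vec_tendstoI)
  then show ?thesis by (simp add: sums_def)
qed

lemma has_fps_expansion_if_sums:
  fixes f :: "complex \<Rightarrow> complex"
  assumes "\<rho> > 0" "\<And>z. z \<in> ball 0 \<rho> \<Longrightarrow> (\<lambda>n. c n * z ^ n) sums f z"
  shows "f has_fps_expansion Abs_fps c"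
proof (rule has_fps_expansionI)
  have "\<forall>\<^sub>F z in nhds 0. z \<in> ball 0 \<rho>"
    using assms(1) by (intro eventually_nhds_in_open) auto
  then show "\<forall>\<^sub>F z in nhds 0. (\<lambda>n. fps_nth (Abs_fps c) n * z ^ n) sums f z"
    by eventually_elim (simp add: assms(2))
qed

abbreviation slit :: "complex set" where
  "slit \<equiv> - \<real>\<^sub>\<le>\<^sub>0"

lemma slit_simply_connected: "simply_connected slit"
proof -
  have "(\<real>\<^sub>\<le>\<^sub>0 :: complex set) = complex_of_real ` {..0}"
    by (auto simp: nonpos_Reals_def)
  then show ?thesis using simply_connected_slotted_complex_plane_left[of 0] by simp
qed

lemma slit_open: "open slit"
  by (simp add: open_Compl)

lemma slit_cnj: "cnj ` slit = slit"
proof -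
  have "cnj z \<in> \<real>\<^sub>\<le>\<^sub>0 \<longleftrightarrow> z \<in> \<real>\<^sub>\<le>\<^sub>0" for z by (simp add: complex_nonpos_Reals_iff)
  then show ?thesis by (auto simp: image_cnj_conv_vimage_cnj)
qed

lemma cq_kernel_holomorphic: "cq_kernel \<beta> holomorphic_on slit"
  unfolding cq_kernel_def[abs_def] by (intro holomorphic_intros) auto

lemma cq_kernel_cnj:
  assumes "s \<in> slit"
  shows "cq_kernel \<beta> (cnj s) = cnj (cq_kernel \<beta> s)"
  using cnj_powr[of s "- of_real \<beta>"] assms
  by (auto simp: cq_kernel_def complex_nonpos_Reals_iff)

lemma cq_kernel_double: "cq_kernel (2 * \<alpha>) s = cq_kernel \<alpha> s * cq_kernel \<alpha> s"
  by (cases "s = 0") (simp_all add: cq_kernel_def flip: powr_add)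

lemma cmat_mult: "cmat (X ** Y) = cmat X ** cmat Y"
  by (simp add: vec_eq_iff matrix_matrix_mult_def)

lemma cmat_mat: "cmat (mat a) = mat (of_real a)"
  by (simp add: vec_eq_iff mat_def)

lemma matrix_inv_cnj:
  assumes "invertible (X :: complex^'n^'n)"
  shows "matrix_inv (map_matrix cnj X) = map_matrix cnj (matrix_inv X)"
  by (rule matrix_inv_eqI)
    (simp flip: map_matrix_cnj_mult add: matrix_inv_cancel[OF assms] map_matrix_cnj_mat)

definition rk_matrix :: "real^'r^'r \<Rightarrow> real^'r \<Rightarrow> complex \<Rightarrow> complex^'r^'r" where
  "rk_matrix A b z = cmat A + map_matrix ((*) (z / (1 - z))) (cmat (\<chi> i j. b $ j))"

text \<open>The generating function \<open>K(\<gamma>(z)/h)\<close> of the weights.\<close>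

definition cq_symbol :: "real^'r^'r \<Rightarrow> real^'r \<Rightarrow> real \<Rightarrow> real \<Rightarrow> complex \<Rightarrow> complex^'r^'r" where
  "cq_symbol A b h \<beta> z = hol_calc slit (cq_kernel \<beta>) (rk_gamma A b z /\<^sub>R h)"

lemma rk_gamma_eq: "rk_gamma A b z = matrix_inv (rk_matrix A b z)"
  by (simp add: rk_gamma_def rk_matrix_def)

lemma rk_gamma_0: 
  assumes "invertible A"
  shows "invertible (cmat A)" "rk_gamma A b 0 = matrix_inv (cmat A)"
proof -
  have "cmat A ** cmat (matrix_inv A) = mat 1"
    by (simp flip: cmat_mult add: matrix_inv_cancel[OF assms] cmat_mat)
  then show "invertible (cmat A)" using invertible_right_inverse by blast
  have "rk_matrix A b 0 = cmat A" by (simp add: rk_matrix_def vec_eq_iff)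
  then show "rk_gamma A b 0 = matrix_inv (cmat A)" by (simp add: rk_gamma_eq)
qed

text \<open>At \<open>z = 0\<close> the matrix to be inverted is \<open>A\<close>, so it stays invertible near \<open>0\<close>.\<close>

lemma rk_gamma_holomorphic:
  fixes A :: "real^'r^'r"
  assumes A: "invertible A"
  obtains S where "open S" "0 \<in> S" "\<And>i j. (\<lambda>z. rk_gamma A b z $ i $ j) holomorphic_on S"
    "\<And>z. z \<in> S \<Longrightarrow> rk_gamma A b (cnj z) = map_matrix cnj (rk_gamma A b z)"
proof -
  define S where "S = ball 0 1 \<inter> (\<lambda>z. det (rk_matrix A b z)) -` (- {0})"
  have hol: "(\<lambda>z. rk_matrix A b z $ i $ j) holomorphic_on ball 0 1" for i j
    by (auto simp: rk_matrix_def intro!: holomorphic_intros)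
  have "open S"
    unfolding S_def
    by (intro continuous_open_preimage holomorphic_on_imp_continuous_on holomorphic_on_det hol) auto
  moreover have "0 \<in> S"
  proof -
    have "rk_matrix A b 0 = cmat A" by (simp add: rk_matrix_def vec_eq_iff)
    then show ?thesis
      using rk_gamma_0(1)[OF A] by (simp add: S_def invertible_det_nz)
  qed
  moreover have inv: "invertible (rk_matrix A b z)" if "z \<in> S" for z
    using that by (simp add: S_def invertible_det_nz)
  have "(\<lambda>z. rk_gamma A b z $ i $ j) holomorphic_on S" for i j
    unfolding rk_gamma_eq
    by (intro holomorphic_on_matrix_inv inv holomorphic_on_subset[OF hol]) (auto simp: S_def)
  moreover have "rk_gamma A b (cnj z) = map_matrix cnj (rk_gamma A b z)" if "z \<in> S" for z
  proof -
    have "rk_matrix A b (cnj z) = map_matrix cnj (rk_matrix A b z)"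
      by (simp add: rk_matrix_def vec_eq_iff)
    then show ?thesis by (simp add: rk_gamma_eq matrix_inv_cnj inv that)
  qed
  ultimately show thesis using that by blast
qed

lemma spectrum_rk_gamma_0:
  assumes A: "invertible A" and spec: "spectrum (cmat A) \<inter> \<real>\<^sub>\<le>\<^sub>0 = {}" and h: "h > 0"
  shows "spectrum (rk_gamma A b 0 /\<^sub>R h) \<subseteq> slit"
proof
  fix s assume "s \<in> spectrum (rk_gamma A b 0 /\<^sub>R h)"
  then obtain v where v: "v \<noteq> 0" "(rk_gamma A b 0 /\<^sub>R h) *v v = s *s v"
    by (auto simp: spectrum_def)
  have "(rk_gamma A b 0 /\<^sub>R h) *v v = (1 / of_real h) *s (rk_gamma A b 0 *v v)"
    by (simp add: vec_eq_iff matrix_vector_mult_def scaleR_conv_of_real[where 'a = complex]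
        sum_distrib_left divide_inverse mult.assoc)
  then have "rk_gamma A b 0 *v v = (of_real h * s) *s v"
    using v(2) h by (simp add: vec_eq_iff divide_simps) (simp add: mult_ac)
  then have "cmat A *v (rk_gamma A b 0 *v v) = (of_real h * s) *s (cmat A *v v)"
    by (simp add: vec_eq_iff matrix_vector_mult_def sum_distrib_left mult_ac)
  then have *: "v = (of_real h * s) *s (cmat A *v v)"
    using rk_gamma_0[OF A] by (simp add: matrix_vector_mul_assoc matrix_inv_cancel)
  show "s \<in> slit"
  proof
    assume s: "s \<in> \<real>\<^sub>\<le>\<^sub>0"
    have "s \<noteq> 0" using * v(1) by auto
    then have "cmat A *v v = (1 / (of_real h * s)) *s v"
      using * h by (simp add: vec_eq_iff divide_simps)
    then have "1 / (of_real h * s) \<in> spectrum (cmat A)"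
      using v(1) by (auto simp: spectrum_def)
    moreover obtain x where x: "s = of_real x" "x \<le> 0" using s by (auto elim: nonpos_Reals_cases)
    have "1 / (of_real h * s) = complex_of_real (1 / (h * x))" using x by simp
    moreover have "1 / (h * x) \<le> 0" using x h by (simp add: mult_nonneg_nonpos)
    ultimately show False using spec by (metis IntI empty_iff nonpos_Reals_of_real_iff)
  qed
qed

lemma cq_symbol_holomorphic:
  fixes A :: "real^'r^'r"
  assumes A: "invertible A" and spec: "spectrum (cmat A) \<inter> \<real>\<^sub>\<le>\<^sub>0 = {}" and h: "h > 0"
  obtains \<rho> where "\<rho> > 0" "\<And>z. z \<in> ball 0 \<rho> \<Longrightarrow> spectrum (rk_gamma A b z /\<^sub>R h) \<subseteq> slit"
    "\<And>i j. (\<lambda>z. cq_symbol A b h \<beta> z $ i $ j) holomorphic_on ball 0 \<rho>"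
    "\<And>z. z \<in> ball 0 \<rho> \<Longrightarrow> cq_symbol A b h \<beta> (cnj z) = map_matrix cnj (cq_symbol A b h \<beta> z)"
proof -
  obtain S where S: "open S" "0 \<in> S" "\<And>i j. (\<lambda>z. rk_gamma A b z $ i $ j) holomorphic_on S"
    "\<And>z. z \<in> S \<Longrightarrow> rk_gamma A b (cnj z) = map_matrix cnj (rk_gamma A b z)"
    using rk_gamma_holomorphic[OF A] by blast
  have hol: "(\<lambda>z. (rk_gamma A b z /\<^sub>R h) $ i $ j) holomorphic_on S" for i j
    by (simp add: scaleR_conv_of_real[where 'a = complex]) (intro holomorphic_intros S(3))
  obtain \<rho> where \<rho>: "\<rho> > 0" "ball 0 \<rho> \<subseteq> S"
    "\<And>z. z \<in> ball 0 \<rho> \<Longrightarrow> spectrum (rk_gamma A b z /\<^sub>R h) \<subseteq> slit"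
    "\<And>i j. (\<lambda>z. hol_calc slit (cq_kernel \<beta>) (rk_gamma A b z /\<^sub>R h) $ i $ j) holomorphic_on ball 0 \<rho>"
    using hol_calc_holomorphic[OF slit_open slit_simply_connected cq_kernel_holomorphic S(1,2) hol
        spectrum_rk_gamma_0[OF A spec h]] by blast
  have "cq_symbol A b h \<beta> (cnj z) = map_matrix cnj (cq_symbol A b h \<beta> z)" if z: "z \<in> ball 0 \<rho>" for z
  proof -
    have "rk_gamma A b (cnj z) /\<^sub>R h = map_matrix cnj (rk_gamma A b z /\<^sub>R h)"
      using S(4) \<rho>(2) z by (auto simp: vec_eq_iff)
    then show ?thesis
      unfolding cq_symbol_def
      using hol_calc_cnj[OF slit_open slit_simply_connected slit_cnj \<rho>(3)[OF z]
          cq_kernel_holomorphic cq_kernel_cnj] by simp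
  qed
  then show thesis using that \<rho> by (simp add: cq_symbol_def)
qed

text \<open>The generating function is analytic at \<open>0\<close> and commutes with conjugation there, so its Taylor
  coefficients are real. They solve the description in \<^const>\<open>cq_weight\<close>, uniquely by the identity
  theorem for power series.\<close>

lemma cq_weight_has_fps_expansion:
  fixes A :: "real^'r^'r"
  assumes A: "invertible A" and spec: "spectrum (cmat A) \<inter> \<real>\<^sub>\<le>\<^sub>0 = {}" and h: "h > 0"
  shows "(\<lambda>z. cq_symbol A b h \<beta> z $ i $ j) has_fps_expansion
    Abs_fps (\<lambda>n. of_real (cq_weight A b h \<beta> n $ i $ j))"
proof -
  define \<Phi> where "\<Phi> = cq_symbol A b h \<beta>"
  define P where "P W \<longleftrightarrow> (\<exists>\<rho>>0. \<forall>z\<in>ball 0 \<rho>.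
     (\<lambda>n. map_matrix ((*) (z ^ n)) (cmat (W n))) sums \<Phi> z)" for W :: "nat \<Rightarrow> real^'r^'r"
  have P_fps: "(\<lambda>z. \<Phi> z $ i $ j) has_fps_expansion Abs_fps (\<lambda>n. of_real (W n $ i $ j))"
    if "P W" for W i j
  proof -
    obtain \<rho> where "\<rho> > 0" and "\<forall>z\<in>ball 0 \<rho>. (\<lambda>n. map_matrix ((*) (z ^ n)) (cmat (W n))) sums \<Phi> z"
      using \<open>P W\<close> unfolding P_def by blast
    then show ?thesis
      by (intro has_fps_expansion_if_sums[of \<rho>]) (auto simp: sums_matrix_iff mult.commute)
  qed
  obtain \<rho> where \<rho>: "\<rho> > 0" "\<And>i j. (\<lambda>z. \<Phi> z $ i $ j) holomorphic_on ball 0 \<rho>"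
    "\<And>z. z \<in> ball 0 \<rho> \<Longrightarrow> \<Phi> (cnj z) = map_matrix cnj (\<Phi> z)"
    unfolding \<Phi>_def using cq_symbol_holomorphic[OF assms] by metis
  define F where "F i j = fps_expansion (\<lambda>z. \<Phi> z $ i $ j) 0" for i j
  have F: "(\<lambda>z. \<Phi> z $ i $ j) has_fps_expansion F i j" for i j
    unfolding F_def using \<rho>(1,2)
    by (intro analytic_at_imp_has_fps_expansion_0) (auto simp: analytic_at intro!: exI[of _ "ball 0 \<rho>"])
  have F_sums: "(\<lambda>n. fps_nth (F i j) n * z ^ n) sums \<Phi> z $ i $ j" if "z \<in> ball 0 \<rho>" for i j z
    using has_fps_expansion_imp_sums_complex[OF F, where r = "ereal \<rho>"] \<rho>(2) that by simp
  have "(\<lambda>z. \<Phi> z $ i $ j) has_fps_expansion Abs_fps (\<lambda>n. cnj (fps_nth (F i j) n))" for i j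
  proof (rule has_fps_expansion_if_sums[OF \<rho>(1)])
    fix z :: complex assume z: "z \<in> ball 0 \<rho>"
    then have "(\<lambda>n. fps_nth (F i j) n * cnj z ^ n) sums cnj (\<Phi> z $ i $ j)"
      using F_sums[of "cnj z" i j] \<rho>(3)[OF z] by simp
    then have "(\<lambda>n. cnj (fps_nth (F i j) n * cnj z ^ n)) sums cnj (cnj (\<Phi> z $ i $ j))"
      by (simp only: sums_cnj)
    then show "(\<lambda>n. cnj (fps_nth (F i j) n) * z ^ n) sums \<Phi> z $ i $ j" by simp
  qed
  then have "F i j = Abs_fps (\<lambda>n. cnj (fps_nth (F i j) n))" for i j
    using F fps_expansion_unique_complex by blast
  then have "cnj (fps_nth (F i j) n) = fps_nth (F i j) n" for i j n
    by (metis fps_nth_Abs_fps)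
  then have real: "of_real (Re (fps_nth (F i j) n)) = fps_nth (F i j) n" for i j n
    by (metis Reals_cnj_iff of_real_Re)
  define W where "W n = (\<chi> i j. Re (fps_nth (F i j) n))" for n
  have "P W"
    unfolding P_def
    using \<rho>(1) F_sums by (auto intro!: exI[of _ \<rho>] simp: sums_matrix_iff W_def real mult.commute)
  moreover have "V = W" if "P V" for V
  proof (rule ext)
    fix n
    have "of_real (V n $ i $ j) = (of_real (W n $ i $ j) :: complex)" for i j
      using fps_expansion_unique_complex[OF P_fps[OF that] P_fps[OF \<open>P W\<close>], of i j]
      by (metis fps_nth_Abs_fps)
    then show "V n = W n" by (simp add: vec_eq_iff)
  qed
  ultimately have "P (THE W. P W)" by (rule theI)
  also have "(THE W. P W) = cq_weight A b h \<beta>"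
    by (simp only: P_def[abs_def] \<Phi>_def cq_symbol_def cq_weight_def)
  finally show ?thesis using P_fps[of "cq_weight A b h \<beta>"] by (simp add: \<Phi>_def)
qed

text \<open>The generating function of order \<open>2 \<alpha>\<close> is the square of the one of order \<open>\<alpha>\<close>.\<close>

lemma cq_weight_double:
  fixes A :: "real^'r^'r"
  assumes A: "invertible A" and spec: "spectrum (cmat A) \<inter> \<real>\<^sub>\<le>\<^sub>0 = {}" and h: "h > 0"
  shows "cq_weight A b h (2 * \<alpha>) n =
    (\<Sum>m\<le>n. cq_weight A b h \<alpha> m ** cq_weight A b h \<alpha> (n - m))"
proof -
  define W where "W = cq_weight A b h \<alpha>"
  define F where "F i j = Abs_fps (\<lambda>n. complex_of_real (W n $ i $ j))" for i j
  have exp: "(\<lambda>z. cq_symbol A b h \<alpha> z $ i $ j) has_fps_expansion F i j" for i j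
    unfolding F_def W_def by (rule cq_weight_has_fps_expansion[OF assms])
  obtain \<rho> where \<rho>: "\<rho> > 0" "\<And>z. z \<in> ball 0 \<rho> \<Longrightarrow> spectrum (rk_gamma A b z /\<^sub>R h) \<subseteq> slit"
    using cq_symbol_holomorphic[OF assms] by metis
  have mult: "cq_symbol A b h (2 * \<alpha>) z = cq_symbol A b h \<alpha> z ** cq_symbol A b h \<alpha> z"
    if "z \<in> ball 0 \<rho>" for z
    using hol_calc_mult[OF slit_open slit_simply_connected \<rho>(2)[OF that]
        cq_kernel_holomorphic[of \<alpha>] cq_kernel_holomorphic[of \<alpha>]]
    by (simp add: cq_symbol_def cq_kernel_double[abs_def])
  have "complex_of_real (cq_weight A b h (2 * \<alpha>) n $ i $ j) =
      of_real ((\<Sum>m\<le>n. W m ** W (n - m)) $ i $ j)" for i j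
  proof -
    have "(\<lambda>z. \<Sum>k\<in>UNIV. cq_symbol A b h \<alpha> z $ i $ k * cq_symbol A b h \<alpha> z $ k $ j)
        has_fps_expansion (\<Sum>k\<in>UNIV. F i k * F k j)"
      by (intro has_fps_expansion_sum has_fps_expansion_mult exp)
    moreover have "\<forall>\<^sub>F z in nhds 0. z \<in> ball 0 \<rho>"
      using \<rho>(1) by (intro eventually_nhds_in_open) auto
    then have "\<forall>\<^sub>F z in nhds 0. (\<Sum>k\<in>UNIV. cq_symbol A b h \<alpha> z $ i $ k * cq_symbol A b h \<alpha> z $ k $ j) =
        cq_symbol A b h (2 * \<alpha>) z $ i $ j"
      by eventually_elim (simp add: mult matrix_matrix_mult_def)
    ultimately have "(\<lambda>z. cq_symbol A b h (2 * \<alpha>) z $ i $ j) has_fps_expansion (\<Sum>k\<in>UNIV. F i k * F k j)"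
      by (subst (asm) has_fps_expansion_cong) auto
    then have "Abs_fps (\<lambda>n. complex_of_real (cq_weight A b h (2 * \<alpha>) n $ i $ j)) = (\<Sum>k\<in>UNIV. F i k * F k j)"
      using cq_weight_has_fps_expansion[OF assms] fps_expansion_unique_complex by blast
    then have "complex_of_real (cq_weight A b h (2 * \<alpha>) n $ i $ j) = fps_nth (\<Sum>k\<in>UNIV. F i k * F k j) n"
      by (metis fps_nth_Abs_fps)
    also have "\<dots> = (\<Sum>k\<in>UNIV. \<Sum>m\<le>n. of_real (W m $ i $ k * W (n - m) $ k $ j))"
      by (simp add: fps_sum_nth fps_mult_nth F_def atLeast0AtMost)
    also have "\<dots> = of_real ((\<Sum>m\<le>n. W m ** W (n - m)) $ i $ j)"
      by (subst sum.swap) (simp add: matrix_matrix_mult_def)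
    finally show ?thesis .
  qed
  then have "cq_weight A b h (2 * \<alpha>) n $ i $ j = (\<Sum>m\<le>n. W m ** W (n - m)) $ i $ j" for i j
    using of_real_eq_iff by blast
  then show ?thesis unfolding W_def vec_eq_iff by blast
qed

section \<open>Semigroup property and integration by parts\<close>

lemma matrix_vector_mult_sum_right: "X *v (\<Sum>k\<in>K. v k) = (\<Sum>k\<in>K. X *v v k)"
  for X :: "real^'n^'m"
  by (induction K rule: infinite_finite_induct) (simp_all add: matrix_vector_right_distrib)

lemma matrix_vector_mult_sum_left: "(\<Sum>k\<in>K. X k) *v v = (\<Sum>k\<in>K. X k *v v)"
  for v :: "real^'n"
  by (induction K rule: infinite_finite_induct) (simp_all add: matrix_vector_mult_add_rdistrib)

lemma retarded_cq_twice:
  assumes W2: "\<And>n. cq_weight A b h (2 * \<alpha>) n =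
    (\<Sum>m\<le>n. cq_weight A b h \<alpha> m ** cq_weight A b h \<alpha> (n - m))"
  shows "retarded_cq A b h \<alpha> (retarded_cq A b h \<alpha> f) k = retarded_cq A b h (2 * \<alpha>) f k"
proof -
  define W where "W = cq_weight A b h \<alpha>"
  have "retarded_cq A b h \<alpha> (retarded_cq A b h \<alpha> f) k =
      (\<Sum>n\<le>k. \<Sum>m\<le>n. (W (k - n) ** W (n - m)) *v f m)"
    by (simp add: retarded_cq_def W_def matrix_vector_mult_sum_right matrix_vector_mul_assoc
        atLeast0AtMost)
  also have "\<dots> = (\<Sum>m\<le>k. \<Sum>p\<le>k - m. (W p ** W (k - m - p)) *v f m)"
    unfolding sum.Sigma[OF finite_atMost ballI[OF finite_atMost]]
    by (rule sum.reindex_bij_witness[of _ "\<lambda>(m, p). (k - p, m)" "\<lambda>(n, m). (m, k - n)"])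
      (auto simp: diff_right_commute)
  also have "\<dots> = retarded_cq A b h (2 * \<alpha>) f k"
    by (simp add: retarded_cq_def W2 W_def matrix_vector_mult_sum_left atLeast0AtMost)
  finally show ?thesis .
qed

lemma transpose_sum: "transpose (\<Sum>k\<in>K. X k) = (\<Sum>k\<in>K. transpose (X k))"
  by (simp add: vec_eq_iff transpose_def)

text \<open>Transposition reverses the factors in the Cauchy product. This is harmless, since both factors
  are taken from the same sequence.\<close>

lemma advanced_cq_twice:
  assumes W2: "\<And>n. cq_weight A b h (2 * \<alpha>) n =
    (\<Sum>m\<le>n. cq_weight A b h \<alpha> m ** cq_weight A b h \<alpha> (n - m))"
  shows "advanced_cq A b h N \<alpha> (advanced_cq A b h N \<alpha> f) k = advanced_cq A b h N (2 * \<alpha>) f k"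
proof -
  define V where "V n = transpose (cq_weight A b h \<alpha> n)" for n
  have V: "advanced_cq A b h N \<alpha> u k = (\<Sum>n\<le>N - k. V n *v u (k + n))" for u k
    by (simp only: advanced_cq_def V_def atLeast0AtMost)
  have V2: "transpose (cq_weight A b h (2 * \<alpha>) l) = (\<Sum>m\<le>l. V (l - m) ** V m)" for l
    by (simp add: W2 V_def transpose_sum matrix_transpose_mul)
  have "advanced_cq A b h N \<alpha> (advanced_cq A b h N \<alpha> f) k =
      (\<Sum>n\<le>N - k. \<Sum>m\<le>N - k - n. (V n ** V m) *v f (k + n + m))"
    by (simp add: V matrix_vector_mult_sum_right matrix_vector_mul_assoc)
  also have "\<dots> = (\<Sum>l\<le>N - k. \<Sum>m\<le>l. (V (l - m) ** V m) *v f (k + l))"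
    unfolding sum.Sigma[OF finite_atMost ballI[OF finite_atMost]]
    by (rule sum.reindex_bij_witness[of _ "\<lambda>(l, m). (l - m, m)" "\<lambda>(n, m). (n + m, m)"])
      (auto simp: add.assoc)
  also have "\<dots> = advanced_cq A b h N (2 * \<alpha>) f k"
    by (simp only: advanced_cq_def V2 matrix_vector_mult_sum_left atLeast0AtMost)
  finally show ?thesis .
qed

lemma cq_integration_by_parts:
  "(\<Sum>k=0..N. g k \<bullet> retarded_cq A b h \<alpha> f k) = (\<Sum>k=0..N. advanced_cq A b h N \<alpha> g k \<bullet> f k)"
proof -
  define W where "W = cq_weight A b h \<alpha>"
  have "(\<Sum>k=0..N. g k \<bullet> retarded_cq A b h \<alpha> f k) = (\<Sum>k\<le>N. \<Sum>n\<le>k. g k \<bullet> (W (k - n) *v f n))"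
    by (simp add: retarded_cq_def W_def inner_sum_right atLeast0AtMost)
  also have "\<dots> = (\<Sum>k\<le>N. \<Sum>n\<le>N - k. g (k + n) \<bullet> (W n *v f k))"
    unfolding sum.Sigma[OF finite_atMost ballI[OF finite_atMost]]
    by (rule sum.reindex_bij_witness[of _ "\<lambda>(k, n). (k + n, k)" "\<lambda>(k, n). (n, k - n)"]) auto
  also have "\<dots> = (\<Sum>k=0..N. advanced_cq A b h N \<alpha> g k \<bullet> f k)"
    by (simp add: advanced_cq_def W_def inner_sum_left atLeast0AtMost dot_lmul_matrix)
  finally show ?thesis .
qed

theorem lemma4p1:
  fixes A :: "real^'r^'r" and b c :: "real^'r"
    and \<alpha> h :: real and N :: nat and f g :: "nat \<Rightarrow> real^'r"
  assumes "\<forall>i. c $ i \<in> {0..1}"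
    and "invertible A"
    and "\<forall>y::real. norm (stability_function A b (\<i> * of_real y)) \<le> 1"
    and "stability_function A b analytic_on {z. Re z < 1}"
    and "spectrum (cmat A) \<inter> \<real>\<^sub>\<le>\<^sub>0 = {}"
    and "\<alpha> > 0" and "h > 0"
  shows "(\<forall>k\<le>N.
            retarded_cq A b h \<alpha> (retarded_cq A b h \<alpha> f) k = retarded_cq A b h (2 * \<alpha>) f k \<and>
            advanced_cq A b h N \<alpha> (advanced_cq A b h N \<alpha> f) k = advanced_cq A b h N (2 * \<alpha>) f k) \<and>
         (\<Sum>k=0..N. g k \<bullet> retarded_cq A b h \<alpha> f k) =
         (\<Sum>k=0..N. advanced_cq A b h N \<alpha> g k \<bullet> f k)"
proof -
  note W2 = cq_weight_double[OF \<open>invertible A\<close> \<open>spectrum (cmat A) \<inter> \<real>\<^sub>\<le>\<^sub>0 = {}\<close> \<open>h > 0\<close>]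
  show ?thesis
    using retarded_cq_twice[OF W2] advanced_cq_twice[OF W2] cq_integration_by_parts by blast
qed

end
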